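(* Consider a class $\mathcal C$ of permutations that is closed under elementary reductions and extensions. Let $p(n,k)$ and $r(n,k)$ respectively be the number of all, respectively all reduced, permutations of $\{1,\ldots,n\}$ in the class having $k$ cycles. Then the generating functions $P(x,y):=\sum_{n,k}p(n,k)x^ny^k$ and $R(x,y):=\sum_{n,k}r(n,k)x^ny^k$ satisfy the equation $$P(x,y)=R\left(\frac{D(x,y)-1}{y},\,y\right)\cdot\frac{1}{\sqrt{(x+xy-1)^2-4x^2y}}.$$
   Context: A class of permutations is a set of permutations, each one a permutation of $\{1,\ldots,n\}$ for some $n$; the degenerate bijection of the empty set with itself is also considered a permutation. Let $\zeta_n=(1,2,\ldots,n)$; $i+1$ means $\zeta_n(i)$ (addition modulo $n$). Products are composed right to left, and fixed points count as cycles. An elementary reduction of the first kind: given $i$ with $\alpha(i)=i$, remove the cycle $(i)$ from the cycle decomposition of the permutation $\alpha$ of $\{1,\ldots,n\}$ and replace every $j>i$ by $j-1$, obtaining a permutation of $\{1,\ldots,n-1\}$. An elementary reduction of the second kind: given a dual fixed point $i$ of $\alpha$, i.e. $\alpha(i)=i+1$ (including $i=n$ with $\alpha(n)=1$), remove $i$ from the cycle containing it and replace every $j>i$ by $j-1$, obtaining a permutation of $\{1,\ldots,n-1\}$. Elementary extensions (of the first and second kind) are the inverses of these operations, assigning $\alpha$ to the resulting permutation $\alpha'$. A class is closed under elementary reductions and extensions if every result of applying such an operation to a member is again a member. A permutation $\alpha$ of $\{1,\ldots,n\}$ is reduced if neither $\alpha$ nor $\alpha^{-1}\zeta_n$ has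 any fixed points, that is, if $\alpha$ has no fixed points and no dual fixed points. $D(x,y)=1+\sum_{n\ge1}\sum_{k=1}^n\frac1n\binom nk\binom n{k-1}x^ny^k$ is the generating function of noncrossing partitions (the coefficient of $x^ny^k$ is the number of noncrossing partitions of $\{1,\ldots,n\}$ with $k$ parts, with constant term $1$ by convention). The square root is the formal power series square root with constant term $1$.
   Formalization: The class is additionally assumed not to contain the empty permutation. Any closed class containing it also contains the permutation (1), and then the equation fails at the coefficient of x: it is y on the left but 1+y on the right (for example, for the class of all permutations). *)

theory Defs
  imports
    "HOL-Computational_Algebra.Formal_Power_Series"
    "HOL-Combinatorics.Permutations"
    "HOL-Combinatorics.Orbits"
begin

section \<open>Permutations of \<open>{1..n}\<close> and their cycles\<close>

text \<open>
  A permutation of \<open>{1..n}\<close> is represented by the pair \<open>(n, \<alpha>)\<close>, where \<open>\<alpha> permutes {1..n}\<close>, so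
  that \<open>\<alpha>\<close> is the identity outside \<open>{1..n}\<close>. The size has to be recorded, because one function
  permutes \<open>{1..n}\<close> for many \<open>n\<close>. The permutation of the empty set is \<open>(0, id)\<close>.
\<close>

type_synonym sized_perm = "nat \<times> (nat \<Rightarrow> nat)"

definition perm_class :: "sized_perm set \<Rightarrow> bool" where
  "perm_class C \<longleftrightarrow> (\<forall>(n, \<alpha>) \<in> C. \<alpha> permutes {1..n})"

text \<open>The cyclic permutation \<open>(1, 2, \<dots>, n)\<close>; for \<open>n = 0\<close> it is the identity.\<close>

definition zeta :: "nat \<Rightarrow> nat \<Rightarrow> nat" where
  "zeta n i = (if i \<in> {1..n} then (if i = n then 1 else i + 1) else i)"

text \<open>Only orbits of points of \<open>{1..n}\<close> are counted; fixed points in \<open>{1..n}\<close> contribute.\<close>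

definition num_cycles :: "nat \<Rightarrow> (nat \<Rightarrow> nat) \<Rightarrow> nat" where
  "num_cycles n \<alpha> = card (orbit \<alpha> ` {1..n})"

definition reduced :: "nat \<Rightarrow> (nat \<Rightarrow> nat) \<Rightarrow> bool" where
  "reduced n \<alpha> \<longleftrightarrow> (\<forall>i\<in>{1..n}. \<alpha> i \<noteq> i \<and> (inv \<alpha> \<circ> zeta n) i \<noteq> i)"


section \<open>Elementary reductions and extensions\<close>

text \<open>
  \<open>skip i \<alpha>\<close> is meant to be used on the points different from \<open>i\<close>: it removes \<open>i\<close> from its cycle by
  sending the predecessor of \<open>i\<close> to the successor of \<open>i\<close>. If \<open>i\<close> is a fixed point, this removes
  the cycle \<open>(i)\<close> and changes nothing else.
\<close>

definition skip :: "nat \<Rightarrow> (nat \<Rightarrow> nat) \<Rightarrow> nat \<Rightarrow> nat" where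
  "skip i \<alpha> j = (if \<alpha> j = i then \<alpha> i else \<alpha> j)"

text \<open>
  \<open>lower i\<close> replaces every \<open>j > i\<close> by \<open>j - 1\<close>; on the points different from \<open>i\<close> its inverse is
  \<open>raise i\<close>.
\<close>

definition lower :: "nat \<Rightarrow> nat \<Rightarrow> nat" where
  "lower i j = (if j > i then j - 1 else j)"

definition raise :: "nat \<Rightarrow> nat \<Rightarrow> nat" where
  "raise i j = (if j \<ge> i then j + 1 else j)"

definition remove_point :: "nat \<Rightarrow> (nat \<Rightarrow> nat) \<Rightarrow> nat \<Rightarrow> nat" where
  "remove_point i \<alpha> = lower i \<circ> skip i \<alpha> \<circ> raise i"

inductive elementary_reduction :: "sized_perm \<Rightarrow> sized_perm \<Rightarrow> bool" where
  first_kind: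
    "\<lbrakk>\<alpha> permutes {1..n}; i \<in> {1..n}; \<alpha> i = i\<rbrakk>
      \<Longrightarrow> elementary_reduction (n, \<alpha>) (n - 1, remove_point i \<alpha>)"
| second_kind:
    "\<lbrakk>\<alpha> permutes {1..n}; i \<in> {1..n}; \<alpha> i = zeta n i\<rbrakk>
      \<Longrightarrow> elementary_reduction (n, \<alpha>) (n - 1, remove_point i \<alpha>)"

text \<open>
  A class closed under both operations that contains the empty permutation contains every
  permutation that reduces to it, in particular the one of \<open>{1}\<close>. For such a class the identity
  between the generating functions fails already at the coefficient of \<open>x\<close>: it is \<open>y\<close> for all
  permutations, and \<open>1 + y\<close> on the other side. The empty permutation has two kinds of extension,
  but both give the same result.
\<close>

definition closed_under_reductions :: "sized_perm set \<Rightarrow> bool" where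
  "closed_under_reductions C \<longleftrightarrow> (\<forall>a b. elementary_reduction a b \<longrightarrow> a \<in> C \<longrightarrow> b \<in> C)"

definition closed_under_extensions :: "sized_perm set \<Rightarrow> bool" where
  "closed_under_extensions C \<longleftrightarrow> (\<forall>a b. elementary_reduction a b \<longrightarrow> b \<in> C \<longrightarrow> a \<in> C)"

lemma remove_point_permutes:
  assumes \<alpha>: "\<alpha> permutes {1..n}" and i: "i \<in> {1..n}"
  shows "remove_point i \<alpha> permutes {1..n - 1}"
proof -
  have inj: "inj \<alpha>" using permutes_inj[OF \<alpha>] .
  have out: "\<alpha> j = j" if "j \<notin> {1..n}" for j
    using \<alpha> that by (simp add: permutes_def)
  have inn: "\<alpha> j \<in> {1..n}" if "j \<in> {1..n}" for j
    using permutes_in_image[OF \<alpha>] that by simp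
  have raise_ne: "raise i j \<noteq> i" for j by (simp add: raise_def)
  have skip_ne: "skip i \<alpha> j \<noteq> i" if "j \<noteq> i" for j
    using that unfolding skip_def by (metis inj_eq[OF inj])
  have lower_inj: "a = b" if "lower i a = lower i b" "a \<noteq> i" "b \<noteq> i" for a b
    using that by (auto simp: lower_def split: if_splits)
  have skip_inj: "a = b" if "skip i \<alpha> a = skip i \<alpha> b" "a \<noteq> i" "b \<noteq> i" for a b
    using that unfolding skip_def by (metis inj_eq[OF inj])
  have raise_inj: "a = b" if "raise i a = raise i b" for a b
    using that by (auto simp: raise_def split: if_splits)
  have "inj (remove_point i \<alpha>)"
  proof (rule injI)
    fix a b assume "remove_point i \<alpha> a = remove_point i \<alpha> b"
    hence "skip i \<alpha> (raise i a) = skip i \<alpha> (raise i b)"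
      using lower_inj[OF _ skip_ne[OF raise_ne] skip_ne[OF raise_ne]] by (simp add: remove_point_def)
    thus "a = b" using raise_inj[OF skip_inj[OF _ raise_ne raise_ne]] by simp
  qed
  moreover have "remove_point i \<alpha> j \<in> {1..n - 1}" if "j \<in> {1..n - 1}" for j
  proof -
    have r: "raise i j \<in> {1..n}" using that i by (auto simp: raise_def)
    hence s: "skip i \<alpha> (raise i j) \<in> {1..n}" using inn i by (auto simp: skip_def)
    moreover have "skip i \<alpha> (raise i j) \<noteq> i" using skip_ne raise_ne by blast
    ultimately show ?thesis using i by (auto simp: remove_point_def lower_def)
  qed
  moreover have "remove_point i \<alpha> j = j" if "j \<notin> {1..n - 1}" for j
  proof -
    have "raise i j \<notin> {1..n}" using that i by (auto simp: raise_def)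
    hence "\<alpha> (raise i j) = raise i j" by (rule out)
    thus ?thesis using raise_ne[of j]
      by (auto simp: remove_point_def skip_def lower_def raise_def split: if_splits)
  qed
  ultimately show ?thesis
    by (intro inj_imp_permutes) (auto intro: inj_on_subset)
qed


section \<open>Generating functions\<close>

text \<open>
  Bivariate formal power series in \<open>x\<close> and \<open>y\<close> are series in \<open>x\<close> whose coefficients are series
  in \<open>y\<close>. For \<open>F\<close> without constant term in \<open>x\<close>, the substitution \<open>R(F, y)\<close> is \<open>R oo F\<close>.
\<close>

type_synonym fps2 = "rat fps fps"

abbreviation xvar :: fps2 where "xvar \<equiv> fps_X"
abbreviation yvar :: fps2 where "yvar \<equiv> fps_const fps_X"

definition gen_fun :: "(nat \<Rightarrow> nat \<Rightarrow> rat) \<Rightarrow> fps2" where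
  "gen_fun c = Abs_fps (\<lambda>n. Abs_fps (\<lambda>k. c n k))"

definition perm_count :: "sized_perm set \<Rightarrow> nat \<Rightarrow> nat \<Rightarrow> nat" where
  "perm_count C n k = card {\<alpha>. (n, \<alpha>) \<in> C \<and> num_cycles n \<alpha> = k}"

definition reduced_count :: "sized_perm set \<Rightarrow> nat \<Rightarrow> nat \<Rightarrow> nat" where
  "reduced_count C n k = card {\<alpha>. (n, \<alpha>) \<in> C \<and> reduced n \<alpha> \<and> num_cycles n \<alpha> = k}"

definition all_gf :: "sized_perm set \<Rightarrow> fps2" where
  "all_gf C = gen_fun (\<lambda>n k. of_nat (perm_count C n k))"

definition reduced_gf :: "sized_perm set \<Rightarrow> fps2" where
  "reduced_gf C = gen_fun (\<lambda>n k. of_nat (reduced_count C n k))"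

definition noncrossing_gf :: fps2 where
  "noncrossing_gf = 1 + gen_fun (\<lambda>n k.
     if 1 \<le> k \<and> k \<le> n then 1 / of_nat n * of_nat (n choose k) * of_nat (n choose (k - 1)) else 0)"

text \<open>
  Division by \<open>y\<close> of a series divisible by \<open>y\<close>. The library division does not serve here, as the
  coefficient ring of series in \<open>y\<close> is not a field.
\<close>

definition div_y :: "fps2 \<Rightarrow> fps2" where
  "div_y F = Abs_fps (\<lambda>n. fps_shift 1 (fps_nth F n))"

lemma div_y_noncrossing: "yvar * div_y (noncrossing_gf - 1) = noncrossing_gf - 1"
proof (intro fps_ext)
  fix n k
  show "fps_nth (fps_nth (yvar * div_y (noncrossing_gf - 1)) n) k =
        fps_nth (fps_nth (noncrossing_gf - 1) n) k"
    by (cases k) (simp_all add: div_y_def noncrossing_gf_def gen_fun_def)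
qed

lemma div_y_noncrossing_nth_0: "fps_nth (div_y (noncrossing_gf - 1)) 0 = 0"
  by (rule fps_ext) (simp add: div_y_def noncrossing_gf_def gen_fun_def)

text \<open>
  The square root with constant term \<open>1\<close>. The library root \<open>fps_radical\<close> needs coefficients in a
  field.
\<close>

definition fps2_sqrt :: "fps2 \<Rightarrow> fps2" where
  "fps2_sqrt A = (THE S. S ^ 2 = A \<and> fps_nth S 0 = 1)"

lemma fps2_sqrt_unique:
  fixes S T :: fps2
  assumes "S ^ 2 = T ^ 2" "fps_nth S 0 = 1" "fps_nth T 0 = 1"
  shows "S = T"
proof (rule ccontr)
  assume "S \<noteq> T"
  with assms(1) have "S = - T" by (simp add: power2_eq_iff)
  hence "fps_nth S 0 = - fps_nth T 0" by simp
  with assms(2,3) have "(1 :: rat fps) = - 1" by simp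
  hence "fps_nth (1 :: rat fps) 0 = fps_nth (- 1) 0" by (rule arg_cong)
  thus False by simp
qed

fun sqrt_coeff :: "fps2 \<Rightarrow> nat \<Rightarrow> rat fps" where
  "sqrt_coeff A n =
     (if n = 0 then 1
      else fps_const (1 / 2) *
        (fps_nth A n - (\<Sum>i\<in>{1..<n}. sqrt_coeff A i * sqrt_coeff A (n - i))))"

declare sqrt_coeff.simps [simp del]

lemma fps2_sqrt_exists:
  assumes "fps_nth A 0 = 1"
  shows "Abs_fps (sqrt_coeff A) ^ 2 = A"
proof (rule fps_ext)
  fix n
  let ?s = "sqrt_coeff A"
  have s0: "?s 0 = 1" by (simp add: sqrt_coeff.simps)
  show "fps_nth (Abs_fps ?s ^ 2) n = fps_nth A n"
  proof (cases "n = 0")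
    case True
    thus ?thesis using assms s0 by (simp add: fps_square_nth)
  next
    case False
    have set: "{..n} = insert 0 (insert n {1..<n})" using False by auto
    have half: "fps_const (1 / 2) * f + fps_const (1 / 2) * f = f" for f :: "rat fps"
    proof -
      have "fps_const (1 / 2) + fps_const (1 / 2) = (1 :: rat fps)"
        by (simp only: fps_const_add) simp
      thus ?thesis by (metis distrib_right mult_1)
    qed
    have "fps_nth (Abs_fps ?s ^ 2) n = (\<Sum>i\<in>{1..<n}. ?s i * ?s (n - i)) + (?s n + ?s n)"
      unfolding fps_square_nth set using False s0 by simp
    also have "?s n + ?s n = fps_nth A n - (\<Sum>i\<in>{1..<n}. ?s i * ?s (n - i))"
      using False by (subst (1 2) sqrt_coeff.simps) (simp only: half if_False)
    finally show ?thesis by simp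
  qed
qed

lemma fps2_sqrt:
  assumes "fps_nth A 0 = 1"
  shows "fps2_sqrt A ^ 2 = A" "fps_nth (fps2_sqrt A) 0 = 1"
proof -
  have ex: "Abs_fps (sqrt_coeff A) ^ 2 = A \<and> fps_nth (Abs_fps (sqrt_coeff A)) 0 = 1"
    using fps2_sqrt_exists[OF assms] by (simp add: sqrt_coeff.simps)
  have "fps2_sqrt A ^ 2 = A \<and> fps_nth (fps2_sqrt A) 0 = 1"
    unfolding fps2_sqrt_def by (rule theI) (use ex fps2_sqrt_unique in auto)
  thus "fps2_sqrt A ^ 2 = A" "fps_nth (fps2_sqrt A) 0 = 1" by auto
qed

lemma fps2_mult_inverse:
  fixes S :: fps2
  assumes "fps_nth S 0 = 1"
  shows "S * inverse S = 1"
  using fps_right_inverse[of S "inverse (fps_nth S 0)"] assms by (simp add: fps_inverse_def[of S])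

end

theory Submission
  imports
    Defs
    "HOL-Computational_Algebra.Polynomial"
    "HOL-Library.FuncSet"
begin

unbundle fps_syntax

text \<open>
  Idea: count reduced permutations by inclusion--exclusion over sets of fixed and dual fixed
  points. Mark each point of \<open>{1..n}\<close> as kept, fixed or dual fixed. If no dual fixed point is
  directly followed, cyclically, by a fixed one, then the members that respect the marking
  correspond, by removing the marked points, to arbitrary members on the kept points; otherwise
  there are none. The admissible cyclic words have a transfer matrix with characteristic polynomial
  giving \<open>(1 + x) (1 + x y) - x z\<close>, where \<open>z\<close> marks kept points, so that with
  \<open>B = x / ((1 + x) (1 + x y))\<close> one obtains \<open>R = P(B) x B' / B\<close>. The series \<open>A = (D - 1) / y\<close> is the
  compositional inverse of \<open>B\<close>, and \<open>x A' / A\<close> is the reciprocal of the square root.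
\<close>

section \<open>The generating function of noncrossing partitions\<close>

text \<open>In the word weights a kept point counts z, a fixed mark -y and a dual mark -1; y records
  the cycle that disappears with a fixed point. Small sizes need care. On one point the fixed and
  dual fixed conditions coincide, so the signed expansion is available only from size 2 on; closure
  together with the absence of the empty permutation leaves no members of size 0 or 1. The same
  absence removes the term without kept points, the only one whose series over all lengths is not
  B^m x B' / B. Series in y do not form a field, so neither B' nor quotients by series with constant
  term 0 appear: identities are stated with denominators cleared, and factors are cancelled in an
  integral domain. No closed form of D is presupposed. Its coefficients satisfy a three-term
  recurrence, which is the differential equation of the square root read coefficientwise; the
  quadratic equation that makes A inverse to B follows from this.\<close>

abbreviation narayana_gf :: fps2 where
  "narayana_gf \<equiv> div_y (noncrossing_gf - 1)"

text \<open>
  In terms of \<open>inv_fact2\<close> the Narayana numbers factor, and the recurrence \<open>inv_fact2_pred\<close> remains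
  true with value \<open>0\<close> at the index \<open>- 1\<close>; this absorbs the boundary cases of the three-term
  recurrence below.
\<close>

definition inv_fact2 :: "nat \<Rightarrow> rat" where
  "inv_fact2 i = 1 / (fact i * fact (i + 1))"

lemma inv_fact2_pred: "i > 0 \<Longrightarrow> inv_fact2 (i - 1) = of_nat i * of_nat (i + 1) * inv_fact2 i"
  by (cases i) (simp_all add: inv_fact2_def)

text \<open>The index \<open>j\<close> is the number of parts minus one, since a factor y has been
  divided out.\<close>

lemma narayana_nth: "narayana_gf $ n $ j =
    (if j < n then fact (n - 1) * fact n * inv_fact2 (n - 1 - j) * inv_fact2 j else 0)"
proof (cases "j < n")
  case True
  then obtain i where n: "n = Suc (i + j)"
    by (metis add.commute less_iff_Suc_add)
  have f: "(fact (Suc (i + j)) :: rat) = of_nat (Suc (i + j)) * fact (i + j)"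
    by (rule fact_Suc)
  have "(of_nat (n choose Suc j) :: rat) = fact n / (fact (Suc j) * fact i)"
    unfolding n by (subst binomial_fact) simp_all
  moreover have "(of_nat (n choose j) :: rat) = fact n / (fact j * fact (Suc i))"
    unfolding n by (subst binomial_fact) (simp_all add: Suc_diff_le)
  ultimately show ?thesis
    using True by (simp add: div_y_def noncrossing_gf_def gen_fun_def inv_fact2_def n f del: fact_Suc of_nat_Suc)
qed (simp add: div_y_def noncrossing_gf_def gen_fun_def)

text \<open>Every term of the recurrence is brought to the common factor
  \<open>inv_fact2 i * inv_fact2 j\<close> with \<open>i + j = n\<close>, which is the shape of
  coefficient \<open>j\<close> at size \<open>n + 1\<close>. The polynomial prefactors vanish where
  an index leaves its range.\<close>

lemma narayana_nth_shift1:
  assumes "n = i + j" "n > 0"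
  shows "narayana_gf $ n $ j = fact (n - 1) * fact n * (of_nat i * of_nat (i + 1)) * inv_fact2 i * inv_fact2 j"
    and "(if j < 1 then 0 else narayana_gf $ n $ (j - 1)) =
      fact (n - 1) * fact n * (of_nat j * of_nat (j + 1)) * inv_fact2 i * inv_fact2 j"
  using assms inv_fact2_pred[of i] inv_fact2_pred[of j] by (auto simp: narayana_nth)

text \<open>The multiplier \<open>n - 1\<close> turns \<open>fact (n - 2)\<close> into
  \<open>fact (n - 1)\<close> and makes both sides vanish at \<open>n = 1\<close>. A shift by two
  applies \<open>inv_fact2_pred\<close> twice, hence the factor i^2 (i^2 - 1), which is 0 for i = 0
  and i = 1.\<close>

lemma narayana_nth_shift2:
  fixes n i j :: nat
  assumes n: "n = i + j" "n > 0"
  defines "c \<equiv> fact (n - 1) * fact (n - 1) * inv_fact2 i * inv_fact2 j"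
  shows "of_nat (n - 1) * narayana_gf $ (n - 1) $ j
      = (of_nat i)\<^sup>2 * ((of_nat i)\<^sup>2 - 1) * c" (is ?A)
    and "of_nat (n - 1) * (if j < 1 then 0 else narayana_gf $ (n - 1) $ (j - 1))
      = of_nat i * of_nat (i + 1) * of_nat j * of_nat (j + 1) * c" (is ?B)
    and "of_nat (n - 1) * (if j < 2 then 0 else narayana_gf $ (n - 1) $ (j - 2))
      = (of_nat j)\<^sup>2 * ((of_nat j)\<^sup>2 - 1) * c" (is ?C)
proof -
  have f: "of_nat (n - 1) * fact (n - 2) = (fact (n - 1) :: rat)" if "n \<ge> 2"
    using that fact_reduce[of "n - 1", where 'a = rat] by (simp add: numeral_2_eq_2)
  have two: "inv_fact2 (k - 2) = of_nat k * of_nat (k - 1) * of_nat k * of_nat (k + 1) * inv_fact2 k"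
    if "k \<ge> 2" for k
    using inv_fact2_pred[of k] inv_fact2_pred[of "k - 1"] that
    by (simp add: numeral_2_eq_2 ac_simps)
  have sq: "of_nat k * of_nat (k - 1) * of_nat k * of_nat (k + 1) = (of_nat k)\<^sup>2 * ((of_nat k)\<^sup>2 - 1 :: rat)"
    if "k \<ge> 2" for k
    using that by (simp add: of_nat_diff power2_eq_square algebra_simps)
  show ?A
  proof (cases "i \<ge> 2")
    case True
    have e: "narayana_gf $ (n - 1) $ j
      = fact (n - 2) * fact (n - 1) * inv_fact2 (i - 2) * inv_fact2 j"
      using True n by (simp add: narayana_nth numeral_2_eq_2)
    have "of_nat (n - 1) * narayana_gf $ (n - 1) $ j
       = (of_nat (n - 1) * fact (n - 2)) * fact (n - 1) * inv_fact2 (i - 2) * inv_fact2 j"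
      by (simp only: e mult.assoc)
    also have "\<dots> = fact (n - 1) * fact (n - 1) * inv_fact2 (i - 2) * inv_fact2 j"
      using True n by (subst f) auto
    finally show ?thesis using two[OF True] sq[OF True] by (simp add: c_def)
  next
    case False
    then have "i = 0 \<or> i = 1" by auto
    then show ?thesis using n by (auto simp: narayana_nth)
  qed
  show ?C
  proof (cases "j \<ge> 2")
    case True
    have "n - 1 - 1 - (j - 2) = i" "j - 2 < n - 1" using True n by auto
    then have e: "narayana_gf $ (n - 1) $ (j - 2)
      = fact (n - 2) * fact (n - 1) * inv_fact2 i * inv_fact2 (j - 2)"
      by (simp add: narayana_nth numeral_2_eq_2)
    have "of_nat (n - 1) * narayana_gf $ (n - 1) $ (j - 2)
       = (of_nat (n - 1) * fact (n - 2)) * fact (n - 1) * inv_fact2 i * inv_fact2 (j - 2)"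
      by (simp only: e mult.assoc)
    also have "\<dots> = fact (n - 1) * fact (n - 1) * inv_fact2 i * inv_fact2 (j - 2)"
      using True n by (subst f) auto
    finally show ?thesis using two[OF True] sq[OF True] True by (simp add: c_def)
  next
    case False
    then have "j = 0 \<or> j = 1" by auto
    then show ?thesis using n by (auto simp: narayana_nth)
  qed
  show ?B
  proof (cases "i \<ge> 1 \<and> j \<ge> 1")
    case True
    have "n - 1 - 1 - (j - 1) = i - 1" "j - 1 < n - 1" using True n by auto
    then have e: "narayana_gf $ (n - 1) $ (j - 1)
      = fact (n - 2) * fact (n - 1) * inv_fact2 (i - 1) * inv_fact2 (j - 1)"
      by (simp add: narayana_nth numeral_2_eq_2)
    have "of_nat (n - 1) * narayana_gf $ (n - 1) $ (j - 1)
       = (of_nat (n - 1) * fact (n - 2)) * fact (n - 1) * inv_fact2 (i - 1) * inv_fact2 (j - 1)"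
      by (simp only: e mult.assoc)
    also have "\<dots> = fact (n - 1) * fact (n - 1) * inv_fact2 (i - 1) * inv_fact2 (j - 1)"
      using True n by (subst f) auto
    finally show ?thesis using True inv_fact2_pred[of i] inv_fact2_pred[of j] by (simp add: c_def)
  next
    case False
    then have "i = 0 \<or> j = 0" by auto
    then show ?thesis using n by (auto simp: narayana_nth)
  qed
qed

text \<open>After removal of the common factor, each coefficient is a polynomial identity in
  \<open>i\<close> and \<open>j\<close>. The multipliers come from the discriminant, which is 1 - 2
  (1 + y) x + (1 - y)^2 x^2.\<close>

lemma narayana_recurrence:
  assumes n: "n \<ge> 1"
  shows "of_nat (n + 2) * narayana_gf $ (n + 1)
    = of_nat (2 * n + 1) * (1 + fps_X) * narayana_gf $ n
      - of_nat (n - 1) * (1 - fps_X)\<^sup>2 * narayana_gf $ (n - 1)" (is "?l = ?r")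
proof (rule fps_ext)
  fix j
  define a where "a = narayana_gf $ n"
  define b where "b = narayana_gf $ (n - 1)"
  have r: "?r = of_nat (2 * n + 1) * (a + fps_X ^ 1 * a)
      - of_nat (n - 1) * (b - 2 * (fps_X ^ 1 * b) + fps_X ^ 2 * b)"
    unfolding a_def b_def by (simp add: power2_eq_square algebra_simps)
  have m: "(of_nat k * f) $ j = of_nat k * f $ j" for k and f :: "rat fps"
    by (metis fps_mult_left_const_nth fps_of_nat)
  have m2: "(2 * f) $ j = 2 * f $ j" for f :: "rat fps"
    using m[of 2] by simp
  have rj: "?r $ j = of_nat (2 * n + 1) * (a $ j + (if j < 1 then 0 else a $ (j - 1)))
      - (of_nat (n - 1) * b $ j - 2 * (of_nat (n - 1) * (if j < 1 then 0 else b $ (j - 1)))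
         + of_nat (n - 1) * (if j < 2 then 0 else b $ (j - 2)))"
    unfolding r fps_sub_nth m fps_add_nth m2 fps_X_power_mult_nth
    by (simp add: algebra_simps)
  show "?l $ j = ?r $ j"
  proof (cases "j \<le> n")
    case False
    then show ?thesis using n unfolding rj m by (auto simp: a_def b_def narayana_nth)
  next
    case True
    define i where "i = n - j"
    have nij: "n = i + j" "n > 0" using True n by (auto simp: i_def)
    define h where "h = inv_fact2 i * inv_fact2 j"
    define g :: rat where "g = fact (n - 1)"
    have fn: "fact n = of_nat n * g" "fact (n + 1) = of_nat (n + 1) * (of_nat n * g)"
      using fact_reduce[of n, where 'a = rat] n by (simp_all add: g_def)
    have l: "?l $ j = of_nat (n + 2) * (of_nat n * g * (of_nat (n + 1) * (of_nat n * g)) * h)"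
      unfolding m using True
      by (simp add: narayana_nth h_def i_def fn del: fact_Suc of_nat_Suc) (simp add: fn[simplified])
    define I J :: rat where "I = of_nat i" and "J = of_nat j"
    have N: "of_nat n = I + J" "of_nat (n + 2) = I + J + 2" "of_nat (n + 1) = I + J + 1"
      "of_nat (2 * n + 1) = 2 * (I + J) + 1" "of_nat (i + 1) = I + 1" "of_nat (j + 1) = J + 1"
      by (simp_all add: I_def J_def nij(1))
    have core: "(I + J + 2) * ((I + J) * ((I + J + 1) * (I + J)))
      = (2 * (I + J) + 1) * ((I + J) * (I * (I + 1)) + (I + J) * (J * (J + 1)))
        - (I\<^sup>2 * (I\<^sup>2 - 1) - 2 * (I * (I + 1) * J * (J + 1)) + J\<^sup>2 * (J\<^sup>2 - 1))"
      by (simp add: power2_eq_square algebra_simps)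
    have *: "a * (k * g * (b * (k * g)) * (p * q)) = (g * g * p * q) * (a * (k * (b * k)))"
      "a * (g * (k * g) * b * p * q + g * (k * g) * c * p * q)
        - (d * (g * g * p * q) - 2 * (e * (g * g * p * q)) + f * (g * g * p * q))
       = (g * g * p * q) * (a * (k * b + k * c) - (d - 2 * e + f))" for a b c d e f k p q :: rat
      by (simp_all only: algebra_simps)
    show ?thesis
      unfolding l rj a_def b_def narayana_nth_shift1[OF nij] narayana_nth_shift2[OF nij]
      unfolding g_def[symmetric] fn N h_def I_def[symmetric] J_def[symmetric]
      by (rule trans[OF *(1)[of "I + J + 2" "I + J" "I + J + 1", unfolded core] *(2)[symmetric]])
  qed
qed

text \<open>As \<open>D\<close> has constant term 1, coefficient m of the equation expresses (m + 1)
  d_(m+1) through d_0, ..., d_m, so all coefficients vanish in turn.\<close>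

lemma fps_deriv_eq_scaled_imp_zero:
  fixes d D E :: "('a::{idom, semiring_char_0}) fps"
  assumes "fps_deriv d * D = E * d" "D $ 0 = 1" "d $ 0 = 0"
  shows "d = 0"
proof (rule fps_ext)
  fix n
  show "d $ n = 0 $ n"
  proof (induction n rule: less_induct)
    case (less n)
    show ?case
    proof (cases n)
      case 0
      then show ?thesis using assms(3) by simp
    next
      case (Suc m)
      have z: "d $ k = 0" if "k \<le> m" for k using less[of k] that Suc by simp
      have "(fps_deriv d * D) $ m = (\<Sum>i=0..m. fps_deriv d $ i * D $ (m - i))"
        by (rule fps_mult_nth)
      also have "\<dots> = (\<Sum>i\<in>{m}. fps_deriv d $ i * D $ (m - i))"
        by (rule sum.mono_neutral_right) (auto simp: z)
      finally have "(fps_deriv d * D) $ m = of_nat (m + 1) * d $ (m + 1)"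
        using assms(2) by simp
      moreover have "(E * d) $ m = 0"
        by (simp add: fps_mult_nth z)
      ultimately have "of_nat (m + 1) * d $ (m + 1) = 0" using assms(1) by simp
      then show ?thesis using Suc by (simp del: of_nat_Suc)
    qed
  qed
qed

section \<open>The square root of the discriminant and the quadratic equation\<close>

abbreviation discriminant :: fps2 where
  "discriminant \<equiv> (xvar + xvar * yvar - 1) ^ 2 - 4 * xvar ^ 2 * yvar"

text \<open>The quadratic formula for x y A^2 + (x + x y - 1) A + x = 0, solved for the root of the
  discriminant.\<close>

definition narayana_root :: fps2 where
  "narayana_root = 1 - xvar - xvar * yvar - 2 * xvar * yvar * narayana_gf"

lemma discriminant_nth_0: "discriminant $ 0 = 1"
  by (simp add: power2_eq_square)

lemma narayana_root_nth:
  "narayana_root $ 0 = 1"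
  "narayana_root $ 1 = - (1 + fps_X)"
  "n \<ge> 1 \<Longrightarrow> narayana_root $ (n + 1) = - 2 * fps_X * narayana_gf $ n"
proof -
  have e: "narayana_root = 1 - xvar - yvar * xvar - yvar * (2 * (xvar * narayana_gf))"
    by (simp add: narayana_root_def algebra_simps)
  have two: "(2 * f) $ n = 2 * f $ n" for f :: fps2 and n
    by (metis fps_mult_left_const_nth numeral_fps_const)
  show "narayana_root $ 0 = 1" by (simp add: e two)
  show "narayana_root $ 1 = - (1 + fps_X)" by (simp add: e two div_y_noncrossing_nth_0)
  show "n \<ge> 1 \<Longrightarrow> narayana_root $ (n + 1) = - 2 * fps_X * narayana_gf $ n"
    by (simp add: e two)
qed

text \<open>This is the Narayana recurrence with the index lowered by one. The coefficients 0 and 1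
  of the root do not have the form -2 y N, so \<open>n = 1\<close> is checked directly.\<close>

lemma narayana_root_recurrence:
  assumes "n \<ge> 1"
  shows "of_nat (n + 1) * narayana_root $ (n + 1)
    = (2 * of_nat n - 1) * (1 + fps_X) * narayana_root $ n
      - (of_nat n - 2) * (1 - fps_X)\<^sup>2 * narayana_root $ (n - 1)"
proof -
  consider "n = 1" | m where "n = Suc (Suc m)"
    using assms by (metis One_nat_def less_one not0_implies_Suc not_less)
  then show ?thesis
  proof cases
    case 1
    have "narayana_gf $ 1 = 1"
      by (rule fps_ext) (auto simp: narayana_nth inv_fact2_def)
    then show ?thesis using narayana_root_nth(3)[of 1] 1
      by (simp add: narayana_root_nth(1) narayana_root_nth(2)[simplified] power2_eq_square algebra_simps)
  next
    case 2
    have idx: "n + 1 = m + 3" "n = m + 2" "n - 1 = m + 1" using 2 by simp_all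
    have coef: "2 * of_nat n - 1 = (of_nat (2 * m + 3) :: rat fps)" "of_nat n - 2 = (of_nat m :: rat fps)"
      using 2 by simp_all
    have r: "of_nat (m + 3) * narayana_gf $ (m + 2)
      = of_nat (2 * m + 3) * (1 + fps_X) * narayana_gf $ (m + 1)
        - of_nat m * (1 - fps_X)\<^sup>2 * narayana_gf $ m"
      using narayana_recurrence[of "m + 1"] by (simp add: eval_nat_numeral)
    have s: "narayana_root $ (m + 3) = - 2 * fps_X * narayana_gf $ (m + 2)"
      "narayana_root $ (m + 2) = - 2 * fps_X * narayana_gf $ (m + 1)"
      using narayana_root_nth(3)[of "m + 2"] narayana_root_nth(3)[of "m + 1"]
      by (simp_all add: eval_nat_numeral)
    \<comment> \<open>For \<open>m = 0\<close> the coefficient of x in the root is not -2 y times a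
      Narayana coefficient; the factor \<open>m\<close> hides this.\<close>
    have m: "of_nat m * (1 - fps_X)\<^sup>2 * narayana_root $ (m + 1)
      = of_nat m * (1 - fps_X)\<^sup>2 * (- 2 * fps_X * narayana_gf $ m)"
      using narayana_root_nth(3)[of m] by (cases "m = 0") simp_all
    have *: "a * (- 2 * x * b) = - 2 * x * (a * b)"
      "c * (- 2 * x * d) - e * (- 2 * x * f) = - 2 * x * (c * d - e * f)"
      for a b c d e f x :: "rat fps"
      by (simp_all add: algebra_simps)
    show ?thesis
      unfolding coef idx(1,3) m unfolding idx(2) s
      by (rule trans[OF *(1) trans[OF arg_cong[OF r, of "\<lambda>t. - 2 * fps_X * t"] *(2)[symmetric]]])
  qed
qed

text \<open>The factor on the right is half the derivative of the discriminant, so this is the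
  equation satisfied by its square root. Coefficient \<open>n\<close> is
  \<open>narayana_root_recurrence\<close> for \<open>n \<ge> 1\<close>.\<close>

lemma narayana_root_deriv:
  "fps_deriv narayana_root * discriminant
    = (xvar * (1 - yvar)\<^sup>2 - (1 + yvar)) * narayana_root" (is "?l = ?r")
proof (rule fps_ext)
  fix n
  define s where "s = narayana_root"
  define u where "u = (1 + fps_X :: rat fps)"
  define v where "v = ((1 - fps_X)\<^sup>2 :: rat fps)"
  have c: "fps_const u = 1 + yvar" "fps_const v = (1 - yvar)\<^sup>2"
    by (simp_all add: u_def v_def power2_eq_square flip: fps_const_1_eq_1)
  have d: "discriminant = 1 - fps_const (2 * u) * xvar + fps_const v * xvar\<^sup>2"
    by (simp add: c power2_eq_square algebra_simps flip: fps_const_mult numeral_fps_const)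
  have l: "?l = fps_deriv s - fps_const (2 * u) * (xvar * fps_deriv s)
      + fps_const v * (xvar * (xvar * fps_deriv s))"
    unfolding d s_def by (simp add: algebra_simps power2_eq_square)
  have r: "?r = fps_const v * (xvar * s) - fps_const u * s"
    unfolding c s_def by (simp add: algebra_simps)
  show "?l $ n = ?r $ n"
  proof (cases n)
    case 0
    then show ?thesis unfolding l r
      using narayana_root_nth(1,2) by (simp add: s_def u_def)
  next
    case (Suc m)
    show ?thesis unfolding l r
      using narayana_root_recurrence[of n, folded s_def u_def v_def] Suc
      by (cases m) (simp_all add: algebra_simps)
  qed
qed

text \<open>Both sides solve the same first-order linear differential equation.\<close>

lemma narayana_root_eq_sqrt: "narayana_root = fps2_sqrt discriminant"
proof -
  define S where "S = fps2_sqrt discriminant"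
  define E where "E = xvar * (1 - yvar)\<^sup>2 - (1 + yvar)"
  note sq = fps2_sqrt[OF discriminant_nth_0, folded S_def]
  have dS: "2 * (S * fps_deriv S) = fps_deriv discriminant"
    by (subst sq(1)[symmetric]) (simp add: power2_eq_square algebra_simps)
  have "fps_deriv ((xvar + xvar * c - 1) ^ 2 - 4 * xvar ^ 2 * c)
      = 2 * (xvar * (1 - c)\<^sup>2 - (1 + c))" if "fps_deriv c = 0" for c
    by (simp add: that power2_eq_square algebra_simps del: fps_deriv_eq_0_iff)
  from this[of yvar] have dE: "fps_deriv discriminant = 2 * E"
    by (simp only: fps_deriv_const E_def simp_thms)
  from dS have "2 * (S * fps_deriv S) = 2 * E" unfolding dE .
  then have "S * fps_deriv S = E" by simp
  then have "fps_deriv S * discriminant = E * S"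
    using sq(1) by (metis power2_eq_square mult.commute mult.assoc)
  then have "fps_deriv (narayana_root - S) * discriminant = E * (narayana_root - S)"
    using narayana_root_deriv[folded E_def]
    by (simp only: fps_deriv_sub left_diff_distrib[of "fps_deriv narayana_root"] right_diff_distrib[of E])
  then have "narayana_root - S = 0"
    by (rule fps_deriv_eq_scaled_imp_zero[OF _ discriminant_nth_0])
      (simp add: narayana_root_nth(1) sq(2))
  then show ?thesis by (simp add: S_def)
qed

text \<open>The difference of both sides, times 4 x y, is the discriminant minus the square of
  \<open>narayana_root\<close>, hence 0.\<close>

lemma narayana_functional_equation:
  "narayana_gf = xvar * ((1 + narayana_gf) * (1 + yvar * narayana_gf))"
proof -
  define N where "N = narayana_gf"
  have "4 * x * y * (N - x * ((1 + N) * (1 + y * N)))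
      = (x + x * y - 1) ^ 2 - 4 * x ^ 2 * y - (1 - x - x * y - 2 * x * y * N)\<^sup>2" for x y :: fps2
    by (simp add: power2_eq_square algebra_simps)
  from this[of xvar yvar] have "4 * xvar * yvar * (N - xvar * ((1 + N) * (1 + yvar * N)))
      = discriminant - narayana_root\<^sup>2"
    by (simp only: N_def narayana_root_def)
  then have "4 * xvar * yvar * (N - xvar * ((1 + N) * (1 + yvar * N))) = 0"
    using fps2_sqrt(1)[OF discriminant_nth_0] by (simp only: narayana_root_eq_sqrt diff_self)
  moreover have "(4 :: fps2) * xvar * yvar \<noteq> 0"
    by simp
  ultimately show ?thesis by (simp add: N_def)
qed

section \<open>Removing a point of a permutation\<close>

lemma lower_raise [simp]: "lower i (raise i j) = j"
  by (simp add: lower_def raise_def)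

lemma raise_lower: "j \<noteq> i \<Longrightarrow> raise i (lower i j) = j"
  by (auto simp: lower_def raise_def)

lemma raise_neq [simp]: "raise i j \<noteq> i" "i \<noteq> raise i j"
  by (auto simp: raise_def)

lemma raise_eq_iff [simp]: "raise i j = raise i k \<longleftrightarrow> j = k"
  by (metis lower_raise)

lemma raise_image: "i \<in> {1..n} \<Longrightarrow> raise i ` {1..n - 1} = {1..n} - {i}"
proof -
  assume i: "i \<in> {1..n}"
  have "j \<in> raise i ` {1..n - 1}" if "j \<in> {1..n} - {i}" for j
    using that i by (intro image_eqI[of _ _ "lower i j"]) (auto simp: raise_lower, auto simp: lower_def)
  then have "{1..n} - {i} \<subseteq> raise i ` {1..n - 1}" by blast
  moreover have "raise i ` {1..n - 1} \<subseteq> {1..n} - {i}" using i by (auto simp: raise_def)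
  ultimately show ?thesis by (rule subset_antisym[rotated])
qed

lemma raise_mem: "i \<in> {1..n} \<Longrightarrow> j \<in> {1..n - 1} \<Longrightarrow> raise i j \<in> {1..n}"
  by (auto simp: raise_def)

text \<open>The skipped value is never \<open>i\<close>: if \<open>raise i j\<close> is sent to
  \<open>i\<close>, injectivity forces \<open>\<alpha> i \<noteq> i\<close>. So
  \<open>raise i\<close> undoes the renumbering.\<close>

lemma raise_remove_point:
  assumes "inj \<alpha>"
  shows "raise i (remove_point i \<alpha> j) = skip i \<alpha> (raise i j)"
proof -
  have "skip i \<alpha> (raise i j) \<noteq> i"
    using injD[OF assms, of i "raise i j"] by (auto simp: skip_def)
  then show ?thesis by (simp add: remove_point_def raise_lower)
qed

lemma zeta_permutes: "zeta n permutes {1..n}"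
proof (intro inj_imp_permutes)
  show "inj_on (zeta n) {1..n}"
    by (rule inj_on_inverseI[of _ "\<lambda>j. if j = 1 then n else j - 1"]) (auto simp: zeta_def)
qed (auto simp: zeta_def)

text \<open>Hence dual fixed points other than \<open>i\<close> survive the removal of \<open>i\<close>.\<close>

lemma remove_point_zeta:
  assumes "n \<ge> 2" "i \<in> {1..n}" "j \<in> {1..n - 1}"
  shows "remove_point i (zeta n) j = zeta (n - 1) j"
proof -
  consider "j \<ge> i" "j + 1 = n" "i = 1" | "j \<ge> i" "j + 1 = n" "i > 1" | "j \<ge> i" "j + 1 < n"
    | "j + 1 < i" | "j + 1 = i" "i = n" | "j + 1 = i" "i < n"
  proof -
    have "1 \<le> i" "i \<le> n" "1 \<le> j" "j + 1 \<le> n" using assms by auto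
    then have "(j \<ge> i \<and> j + 1 = n \<and> i = 1) \<or> (j \<ge> i \<and> j + 1 = n \<and> i > 1) \<or> (j \<ge> i \<and> j + 1 < n)
      \<or> j + 1 < i \<or> (j + 1 = i \<and> i = n) \<or> (j + 1 = i \<and> i < n)"
      by linarith
    then show thesis using that by blast
  qed
  then show ?thesis
    by cases (use assms in \<open>simp_all add: remove_point_def skip_def lower_def raise_def zeta_def\<close>)
qed

text \<open>\<open>\<beta>\<close> is extended by the fixed point \<open>i\<close>; the
  transposition then sends \<open>i\<close> to \<open>t\<close> and the former predecessor of
  \<open>t\<close> to \<open>i\<close>.\<close>

definition insert_point :: "nat \<Rightarrow> nat \<Rightarrow> (nat \<Rightarrow> nat) \<Rightarrow> nat \<Rightarrow> nat" where
  "insert_point i t \<beta> =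
     transpose i t \<circ> (\<lambda>j. if j = i then i else raise i (\<beta> (lower i j)))"

lemma insert_point_permutes:
  assumes "\<beta> permutes {1..n - 1}" "i \<in> {1..n}" "t \<in> {1..n}"
  shows "insert_point i t \<beta> permutes {1..n}"
  unfolding insert_point_def
proof (rule permutes_compose)
  define \<gamma> where "\<gamma> = (\<lambda>j. if j = i then i else raise i (\<beta> (lower i j)))"
  have "inj \<gamma>"
  proof (rule injI)
    fix a b assume "\<gamma> a = \<gamma> b"
    moreover have "inj \<beta>" using assms(1) by (rule permutes_inj)
    ultimately have "(a = i \<longleftrightarrow> b = i) \<and> (a \<noteq> i \<longrightarrow> b \<noteq> i \<longrightarrow> lower i a = lower i b)"
      by (auto simp: \<gamma>_def inj_eq split: if_splits)
    then show "a = b" by (metis raise_lower)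
  qed
  moreover have "\<gamma> j \<in> {1..n}" if j: "j \<in> {1..n}" for j
  proof (cases "j = i")
    case False
    then have "lower i j \<in> {1..n - 1}" using j assms(2) by (auto simp: lower_def)
    then have "\<beta> (lower i j) \<in> {1..n - 1}" by (simp only: permutes_in_image[OF assms(1)])
    then show ?thesis using raise_mem[OF assms(2)] False by (simp add: \<gamma>_def)
  qed (use assms(2) in \<open>simp add: \<gamma>_def\<close>)
  moreover have "\<gamma> j = j" if "j \<notin> {1..n}" for j
  proof -
    have "lower i j \<notin> {1..n - 1}" "j \<noteq> i" using that assms(2) by (auto simp: lower_def)
    then show ?thesis using permutes_not_in[OF assms(1)] by (simp add: \<gamma>_def raise_lower)
  qed
  ultimately show "(\<lambda>j. if j = i then i else raise i (\<beta> (lower i j))) permutes {1..n}"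
    unfolding \<gamma>_def[symmetric] by (intro inj_imp_permutes) (auto intro: inj_on_subset)
  show "transpose i t permutes {1..n}"
    using assms(2,3) by (rule permutes_swap_id)
qed

lemma insert_point_same: "insert_point i t \<beta> i = t"
  by (simp add: insert_point_def)

lemma remove_point_insert_point: "remove_point i (insert_point i t \<beta>) = \<beta>"
  by (auto simp: remove_point_def insert_point_def skip_def transpose_def fun_eq_iff)

lemma insert_point_remove_point:
  assumes "inj \<alpha>"
  shows "insert_point i (\<alpha> i) (remove_point i \<alpha>) = \<alpha>"
proof
  fix j
  have "\<alpha> i = \<alpha> j \<Longrightarrow> i = j" using assms by (rule injD)
  then show "insert_point i (\<alpha> i) (remove_point i \<alpha>) j = \<alpha> j"
    by (cases "j = i"; cases "\<alpha> j = i")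
      (auto simp: insert_point_def raise_remove_point[OF assms] raise_lower skip_def transpose_def)
qed

text \<open>Removal forgets only the image of \<open>i\<close>. The two kinds of reduction are
  \<open>t = i\<close> and \<open>t = zeta n i\<close>.\<close>

lemma bij_betw_remove_point:
  assumes "i \<in> {1..n}" "t \<in> {1..n}"
  shows "bij_betw (remove_point i) {\<alpha>. \<alpha> permutes {1..n} \<and> \<alpha> i = t} {\<beta>. \<beta> permutes {1..n - 1}}"
proof (rule bij_betwI[of _ _ _ "insert_point i t"])
  show "remove_point i \<in> {\<alpha>. \<alpha> permutes {1..n} \<and> \<alpha> i = t} \<rightarrow> {\<beta>. \<beta> permutes {1..n - 1}}"
    using remove_point_permutes assms(1) by blast
  show "insert_point i t \<in> {\<beta>. \<beta> permutes {1..n - 1}} \<rightarrow> {\<alpha>. \<alpha> permutes {1..n} \<and> \<alpha> i = t}"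
    using insert_point_permutes[OF _ assms] insert_point_same by blast
qed (auto simp: remove_point_insert_point insert_point_remove_point[OF permutes_inj])

lemma orbit_remove_point_iff:
  assumes "inj \<alpha>"
  shows "y \<in> orbit (remove_point i \<alpha>) x \<longleftrightarrow> raise i y \<in> orbit \<alpha> (raise i x)"
proof
  let ?\<beta> = "remove_point i \<alpha>"
  note rr = raise_remove_point[OF assms]
  assume "y \<in> orbit ?\<beta> x"
  then show "raise i y \<in> orbit \<alpha> (raise i x)"
  proof induction
    case base
    then show ?case unfolding rr
      by (auto simp: skip_def intro: orbit.intros) (metis orbit.intros)
  next
    case (step y)
    then show ?case unfolding rr
      by (auto simp: skip_def intro: orbit.intros) (metis orbit.intros(2))
  qed
next
  let ?\<beta> = "remove_point i \<alpha>"
  have low: "lower i (skip i \<alpha> (raise i u)) = ?\<beta> u" for u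
    by (simp add: remove_point_def)
  \<comment> \<open>The point \<open>i\<close> has no counterpart after removal, so the invariant
    records its successor instead; \<open>\<alpha> i \<noteq> i\<close> ensures that the orbit
    leaves \<open>i\<close> at the next step.\<close>
  have "(z \<noteq> i \<longrightarrow> lower i z \<in> orbit ?\<beta> x) \<and> (z = i \<longrightarrow> \<alpha> i \<noteq> i \<and> lower i (\<alpha> i) \<in> orbit ?\<beta> x)"
    if "z \<in> orbit \<alpha> (raise i x)" for z
    using that
  proof induction
    case base
    show ?case
    proof (intro conjI impI)
      assume "\<alpha> (raise i x) \<noteq> i"
      then have "lower i (\<alpha> (raise i x)) = ?\<beta> x" by (simp add: remove_point_def skip_def)
      then show "lower i (\<alpha> (raise i x)) \<in> orbit ?\<beta> x" by (simp add: orbit.base)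
    next
      assume a: "\<alpha> (raise i x) = i"
      then show "\<alpha> i \<noteq> i" using injD[OF assms, of i "raise i x"] by auto
      from a have "lower i (\<alpha> i) = ?\<beta> x" by (simp add: remove_point_def skip_def)
      then show "lower i (\<alpha> i) \<in> orbit ?\<beta> x" by (simp add: orbit.base)
    qed
  next
    case (step z)
    show ?case
    proof (cases "z = i")
      case True
      then show ?thesis using step.IH by auto
    next
      case False
      then have l: "?\<beta> (lower i z) \<in> orbit ?\<beta> x" using step.IH by (simp add: orbit.step)
      have "?\<beta> (lower i z) = lower i (if \<alpha> z = i then \<alpha> i else \<alpha> z)"
        using False by (simp add: remove_point_def skip_def raise_lower)
      moreover have "\<alpha> z = i \<Longrightarrow> \<alpha> i \<noteq> i" using injD[OF assms, of i z] False by auto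
      ultimately show ?thesis using l by auto
    qed
  qed
  moreover assume "raise i y \<in> orbit \<alpha> (raise i x)"
  ultimately have "lower i (raise i y) \<in> orbit ?\<beta> x" using raise_neq by blast
  then show "y \<in> orbit ?\<beta> x" by simp
qed

lemma orbit_eq_iff:
  assumes "\<alpha> permutes S" "finite S"
  shows "orbit \<alpha> x = orbit \<alpha> y \<longleftrightarrow> y \<in> orbit \<alpha> x"
proof -
  have "permutation \<alpha>" using assms by (auto simp: permutation_permutes)
  then show ?thesis
    using permutation_self_in_orbit orbit_cyclic_eq3[OF cyclic_on_orbit'] by metis
qed

text \<open>Orbits before and after removal are sets of differently numbered points; only the
  coincidences among them can be compared, and these determine their number.\<close>

lemma card_image_cong_kernel:
  assumes "\<And>x y. x \<in> A \<Longrightarrow> y \<in> A \<Longrightarrow> f x = f y \<longleftrightarrow> g x = g y"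
  shows "card (f ` A) = card (g ` A)"
proof (rule bij_betw_same_card)
  show "bij_betw (\<lambda>z. g (SOME x. x \<in> A \<and> f x = z)) (f ` A) (g ` A)"
  proof (rule bij_betw_imageI)
    have sel: "(SOME u. u \<in> A \<and> f u = f x) \<in> A \<and> f (SOME u. u \<in> A \<and> f u = f x) = f x" if "x \<in> A" for x
      using someI[of "\<lambda>u. u \<in> A \<and> f u = f x" x] that by simp
    then have e: "g (SOME u. u \<in> A \<and> f u = f x) = g x" if "x \<in> A" for x
      using assms that by blast
    show "inj_on (\<lambda>z. g (SOME x. x \<in> A \<and> f x = z)) (f ` A)"
      using assms e by (auto simp: inj_on_def)
    show "(\<lambda>z. g (SOME x. x \<in> A \<and> f x = z)) ` f ` A = g ` A"
      using e by (force simp: image_image)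
  qed
qed

text \<open>An orbit is lost only if \<open>i\<close> is its sole point; otherwise
  \<open>\<alpha> i\<close> still represents it.\<close>

lemma num_cycles_remove_point:
  assumes \<alpha>: "\<alpha> permutes {1..n}" and i: "i \<in> {1..n}"
  shows "num_cycles n \<alpha> = num_cycles (n - 1) (remove_point i \<alpha>) + (if n = 1 \<or> \<alpha> i = i then 1 else 0)"
proof -
  define \<beta> where "\<beta> = remove_point i \<alpha>"
  have \<beta>: "\<beta> permutes {1..n - 1}" unfolding \<beta>_def using assms by (rule remove_point_permutes)
  have "orbit \<beta> x = orbit \<beta> y \<longleftrightarrow> orbit \<alpha> (raise i x) = orbit \<alpha> (raise i y)" for x y
    unfolding orbit_eq_iff[OF \<alpha> finite_atLeastAtMost] orbit_eq_iff[OF \<beta> finite_atLeastAtMost]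
    unfolding \<beta>_def by (rule orbit_remove_point_iff[OF permutes_inj[OF \<alpha>]])
  then have "num_cycles (n - 1) \<beta> = card ((\<lambda>x. orbit \<alpha> (raise i x)) ` {1..n - 1})"
    unfolding num_cycles_def by (intro card_image_cong_kernel) blast
  then have c: "num_cycles (n - 1) \<beta> = card (orbit \<alpha> ` ({1..n} - {i}))"
    unfolding raise_image[OF i, symmetric] image_image .
  have ins: "orbit \<alpha> ` {1..n} = insert (orbit \<alpha> i) (orbit \<alpha> ` ({1..n} - {i}))" using i by blast
  show ?thesis
  proof (cases "\<alpha> i = i")
    case True
    then have "orbit \<alpha> i = {i}" by (simp only: orbit_eq_singleton_iff)
    then have "orbit \<alpha> i \<noteq> orbit \<alpha> x" if "x \<noteq> i" for x
      using that orbit_eq_iff[OF \<alpha> finite_atLeastAtMost, of i x] by blast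
    then have "orbit \<alpha> i \<notin> orbit \<alpha> ` ({1..n} - {i})" by blast
    then have "card (insert (orbit \<alpha> i) (orbit \<alpha> ` ({1..n} - {i})))
        = Suc (card (orbit \<alpha> ` ({1..n} - {i})))"
      by (rule card_insert_disjoint[rotated]) (intro finite_imageI finite_Diff finite_atLeastAtMost)
    then have "num_cycles n \<alpha> = Suc (num_cycles (n - 1) \<beta>)"
      by (simp only: num_cycles_def[of n] ins c)
    then show ?thesis using True unfolding \<beta>_def by simp
  next
    case False
    have m: "\<alpha> i \<in> {1..n}" using permutes_in_image[OF \<alpha>] i by blast
    have "orbit \<alpha> i = orbit \<alpha> (\<alpha> i)"
      unfolding orbit_eq_iff[OF \<alpha> finite_atLeastAtMost] by (rule orbit.base)
    then have "orbit \<alpha> i \<in> orbit \<alpha> ` ({1..n} - {i})" 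
      by (rule image_eqI) (use m False in simp)
    then have "insert (orbit \<alpha> i) (orbit \<alpha> ` ({1..n} - {i})) = orbit \<alpha> ` ({1..n} - {i})"
      by (rule insert_absorb)
    then have "num_cycles n \<alpha> = num_cycles (n - 1) \<beta>"
      by (simp only: num_cycles_def[of n] ins c)
    moreover have "n \<noteq> 1" using False m i by auto
    ultimately show ?thesis using False unfolding \<beta>_def by simp
  qed
qed

section \<open>Cyclic words\<close>

datatype letter = Keep | Fix | Dual

lemma UNIV_letter: "UNIV = {Keep, Fix, Dual}"
  using letter.exhaust by auto

instance letter :: finite
  by standard (simp add: UNIV_letter)

lemma sum_UNIV_letter: "(\<Sum>l\<in>UNIV. f l) = f Keep + f Fix + f Dual"
  for f :: "letter \<Rightarrow> 'a::comm_monoid_add"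
  by (simp add: UNIV_letter ac_simps)

definition letter_weight :: "'a \<Rightarrow> 'a \<Rightarrow> 'a \<Rightarrow> letter \<Rightarrow> 'a" where
  "letter_weight a b c l = (case l of Keep \<Rightarrow> a | Fix \<Rightarrow> b | Dual \<Rightarrow> c)"

lemma letter_weight_simps [simp]:
  "letter_weight a b c Keep = a" "letter_weight a b c Fix = b" "letter_weight a b c Dual = c"
  by (simp_all add: letter_weight_def)

abbreviation words :: "nat \<Rightarrow> (nat \<Rightarrow> letter) set" where
  "words n \<equiv> {1..n} \<rightarrow>\<^sub>E UNIV"

definition linear_valid :: "nat \<Rightarrow> (nat \<Rightarrow> letter) \<Rightarrow> bool" where
  "linear_valid n w \<longleftrightarrow> (\<forall>i\<in>{1..<n}. \<not> (w i = Dual \<and> w (Suc i) = Fix))"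

text \<open>A word with a dual fixed point directly before a fixed point contradicts injectivity.\<close>

definition valid :: "nat \<Rightarrow> (nat \<Rightarrow> letter) \<Rightarrow> bool" where
  "valid n w \<longleftrightarrow> (\<forall>i\<in>{1..n}. \<not> (w i = Dual \<and> w (zeta n i) = Fix))"

lemma valid_iff_linear_valid:
  assumes "n \<ge> 1"
  shows "valid n w \<longleftrightarrow> linear_valid n w \<and> \<not> (w n = Dual \<and> w 1 = Fix)"
proof -
  have s: "{1..n} = insert n {1..<n}" using assms by auto
  have "zeta n i = Suc i" if "i \<in> {1..<n}" for i using that by (simp add: zeta_def)
  moreover have "zeta n n = 1" using assms by (simp add: zeta_def)
  ultimately show ?thesis unfolding valid_def linear_valid_def s by auto
qed

lemma sum_words_Suc:
  fixes \<phi> :: "(nat \<Rightarrow> letter) \<Rightarrow> 'a::comm_monoid_add"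
  shows "(\<Sum>w\<in>words (Suc n). \<phi> w) = (\<Sum>w\<in>words n. \<Sum>l\<in>UNIV. \<phi> (w(Suc n := l)))"
proof -
  have s: "{1..Suc n} = insert (Suc n) {1..n}" by auto
  have "(\<Sum>w\<in>words (Suc n). \<phi> w) = (\<Sum>(l, w)\<in>UNIV \<times> words n. \<phi> (w(Suc n := l)))"
    unfolding s PiE_insert_eq
    by (subst sum.reindex[OF inj_combinator]) (auto simp: case_prod_unfold)
  also have "\<dots> = (\<Sum>l\<in>UNIV. \<Sum>w\<in>words n. \<phi> (w(Suc n := l)))"
    by (simp add: sum.cartesian_product)
  finally show ?thesis by (subst (asm) sum.swap)
qed

lemma linear_valid_Suc:
  "n \<ge> 1 \<Longrightarrow> linear_valid (Suc n) (w(Suc n := l)) \<longleftrightarrow> linear_valid n w \<and> \<not> (w n = Dual \<and> l = Fix)"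
proof -
  assume "n \<ge> 1"
  then have s: "{1..<Suc n} = insert n {1..<n}" by auto
  show ?thesis unfolding linear_valid_def s by auto
qed

text \<open>\<open>P\<close> constrains the first and last letter, all that matters when the word is
  closed to a cycle.\<close>

definition word_sum :: "'a::comm_ring_1 \<Rightarrow> 'a \<Rightarrow> (letter \<Rightarrow> letter \<Rightarrow> bool) \<Rightarrow> nat \<Rightarrow> 'a" where
  "word_sum z y P n =
    (\<Sum>w\<in>words n. if linear_valid n w \<and> P (w 1) (w n) then \<Prod>i\<in>{1..n}. letter_weight z (- y) (- 1) (w i) else 0)"

text \<open>An appended letter contributes z - 1 - y; after \<open>Dual\<close> the letter
  \<open>Fix\<close> is forbidden, and its -y is compensated by adding y. \<open>Dual\<close> may
  follow anything. So the only state to remember is whether the last letter is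
  \<open>Dual\<close>.\<close>

lemma word_sum_Suc:
  assumes n: "n \<ge> 1"
  shows "word_sum z y (\<lambda>a b. P a) (Suc n)
      = (z - 1 - y) * word_sum z y (\<lambda>a b. P a) n + y * word_sum z y (\<lambda>a b. P a \<and> b = Dual) n"
    and "word_sum z y (\<lambda>a b. P a \<and> b = Dual) (Suc n) = - word_sum z y (\<lambda>a b. P a) n"
proof -
  let ?p = "\<lambda>w. \<Prod>i\<in>{1..n}. letter_weight z (- y) (- 1) (w i)"
  have one: "(w(Suc n := l)) 1 = w 1" "(w(Suc n := l)) (Suc n) = l" for w :: "nat \<Rightarrow> letter" and l
    using n by simp_all
  have p: "(\<Prod>i\<in>{1..Suc n}. letter_weight z (- y) (- 1) ((w(Suc n := l)) i))
      = ?p w * letter_weight z (- y) (- 1) l" for w l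
  proof -
    have "(\<Prod>i\<in>{1..n}. letter_weight z (- y) (- 1) ((w(Suc n := l)) i)) = ?p w"
      by (rule prod.cong) auto
    then show ?thesis by (simp add: mult.commute)
  qed
  show "word_sum z y (\<lambda>a b. P a) (Suc n)
      = (z - 1 - y) * word_sum z y (\<lambda>a b. P a) n + y * word_sum z y (\<lambda>a b. P a \<and> b = Dual) n"
    unfolding word_sum_def sum_words_Suc linear_valid_Suc[OF n] one p sum_UNIV_letter
      sum_distrib_left sum.distrib[symmetric]
    by (rule sum.cong) (auto simp: algebra_simps)
  show "word_sum z y (\<lambda>a b. P a \<and> b = Dual) (Suc n) = - word_sum z y (\<lambda>a b. P a) n"
    unfolding word_sum_def sum_words_Suc linear_valid_Suc[OF n] one p sum_UNIV_letter
      sum_negf[symmetric]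
    by (rule sum.cong) auto
qed

lemma word_sum_1: "word_sum z y P 1 =
    (if P Keep Keep then z else 0) - (if P Fix Fix then y else 0) - (if P Dual Dual then 1 else 0)"
proof -
  have "word_sum z y P (Suc 0) =
    (if P Keep Keep then z else 0) - (if P Fix Fix then y else 0) - (if P Dual Dual then 1 else 0)"
    unfolding word_sum_def sum_words_Suc sum_UNIV_letter
    by (simp add: linear_valid_def)
  then show ?thesis by simp
qed

text \<open>
  The trace of the \<open>n\<close>th power of a matrix with eigenvalues \<open>0\<close>, \<open>\<lambda>\<close>, \<open>\<mu>\<close>, where \<open>a = \<lambda> + \<mu>\<close> and
  \<open>b = \<lambda> * \<mu>\<close>; the value at \<open>n = 0\<close> ignores the eigenvalue \<open>0\<close>.
\<close>

fun lucas :: "'a::comm_ring_1 \<Rightarrow> 'a \<Rightarrow> nat \<Rightarrow> 'a" where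
  "lucas a b 0 = 2"
| "lucas a b (Suc 0) = a"
| "lucas a b (Suc (Suc n)) = a * lucas a b (Suc n) - b * lucas a b n"

text \<open>Closing linear words to cycles discards those that start with \<open>Fix\<close> and end
  with \<open>Dual\<close>, which leaves \<open>U n - Vd n\<close>. Both sequences obey the
  recurrence of \<open>lucas\<close>.\<close>

lemma sum_valid_words:
  assumes n: "n \<ge> 1"
  shows "(\<Sum>w\<in>words n. if valid n w then \<Prod>i\<in>{1..n}. letter_weight z (- y) (- 1) (w i) else 0)
    = lucas (z - 1 - y) y n"
proof -
  define U where "U = word_sum z y (\<lambda>a b. True)"
  define Ud where "Ud = word_sum z y (\<lambda>a b. True \<and> b = Dual)"
  define V where "V = word_sum z y (\<lambda>a b. a = Fix)"
  define Vd where "Vd = word_sum z y (\<lambda>a b. a = Fix \<and> b = Dual)"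
  let ?k = "z - 1 - y"
  have U: "U (Suc n) = ?k * U n + y * Ud n" "Ud (Suc n) = - U n"
    and V: "V (Suc n) = ?k * V n + y * Vd n" "Vd (Suc n) = - V n" if "n \<ge> 1" for n
    unfolding U_def Ud_def V_def Vd_def by (intro word_sum_Suc that)+
  have one: "U 1 = ?k" "Ud 1 = - 1" "V 1 = - y" "Vd 1 = 0"
    unfolding U_def Ud_def V_def Vd_def word_sum_1 by simp_all
  have main: "U n - Vd n = lucas ?k y n" if "n \<ge> 1" for n
    using that
  proof (induction n rule: less_induct)
    case (less n)
    consider "n = 1" | "n = 2" | m where "n = Suc (Suc m)" "m \<ge> 1"
      using less.prems by (metis One_nat_def Suc_1 not0_implies_Suc not_less_eq_eq le_0_eq nat_le_linear)
    then show ?case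
    proof cases
      case 1
      then show ?thesis by (simp add: one[simplified])
    next
      \<comment> \<open>The word recurrences start at length 1, so length 2 is a second initial
        value; it is (z - 1 - y)^2 - 2 y.\<close>
      case 2
      then have "n = Suc 1" by simp
      then show ?thesis by (simp only: U V order_refl one) (simp add: algebra_simps)
    next
      case 3
      have "U n - Vd n = ?k * (U (Suc m) - Vd (Suc m)) - y * (U m - Vd m)"
        using 3 by (simp add: U V algebra_simps)
      also have "\<dots> = lucas ?k y n"
        using less.IH[of m] less.IH[of "Suc m"] 3 by simp
      finally show ?thesis .
    qed
  qed
  have "(\<Sum>w\<in>words n. if valid n w then \<Prod>i\<in>{1..n}. letter_weight z (- y) (- 1) (w i) else 0) = U n - Vd n"
    unfolding U_def Vd_def word_sum_def valid_iff_linear_valid[OF n] sum_subtractf[symmetric]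
    by (rule sum.cong) auto
  then show ?thesis using main[OF n] by simp
qed

section \<open>Permutations compatible with a word\<close>

definition matches :: "nat \<Rightarrow> (nat \<Rightarrow> nat) \<Rightarrow> nat \<Rightarrow> letter \<Rightarrow> bool" where
  "matches n \<alpha> i l = (case l of Keep \<Rightarrow> True | Fix \<Rightarrow> \<alpha> i = i | Dual \<Rightarrow> \<alpha> i = zeta n i)"

lemma matches_simps [simp]:
  "matches n \<alpha> i Keep" "matches n \<alpha> i Fix \<longleftrightarrow> \<alpha> i = i" "matches n \<alpha> i Dual \<longleftrightarrow> \<alpha> i = zeta n i"
  by (simp_all add: matches_def)

definition compatible :: "nat \<Rightarrow> (nat \<Rightarrow> letter) \<Rightarrow> (nat \<Rightarrow> nat) \<Rightarrow> bool" where
  "compatible n w \<alpha> \<longleftrightarrow> (\<forall>i\<in>{1..n}. matches n \<alpha> i (w i))"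

lemma zeta_eq_iff: "zeta n i = zeta n j \<longleftrightarrow> i = j"
  using permutes_inj[OF zeta_permutes] by (rule inj_eq)

lemma zeta_mem: "i \<in> {1..n} \<Longrightarrow> zeta n i \<in> {1..n}"
  using permutes_in_image[OF zeta_permutes] by blast

lemma zeta_neq: "n \<ge> 2 \<Longrightarrow> i \<in> {1..n} \<Longrightarrow> zeta n i \<noteq> i"
  by (auto simp: zeta_def)

lemma raise_zeta:
  assumes "n \<ge> 2" "i \<in> {1..n}" "j \<in> {1..n - 1}"
  shows "raise i (zeta (n - 1) j) = skip i (zeta n) (raise i j)"
  using raise_remove_point[OF permutes_inj[OF zeta_permutes], of i n j] remove_point_zeta[OF assms]
  by simp

lemma not_valid_imp_not_compatible:
  assumes n: "n \<ge> 2" and \<alpha>: "\<alpha> permutes {1..n}" and w: "\<not> valid n w"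
  shows "\<not> compatible n w \<alpha>"
proof
  assume c: "compatible n w \<alpha>"
  obtain i where i: "i \<in> {1..n}" "w i = Dual" "w (zeta n i) = Fix"
    using w by (auto simp: valid_def)
  have "matches n \<alpha> i (w i)" "matches n \<alpha> (zeta n i) (w (zeta n i))"
    using c i(1) zeta_mem[OF i(1)] by (simp_all only: compatible_def)
  then have "\<alpha> i = \<alpha> (zeta n i)" by (simp add: i)
  then show False
    using permutes_inj[OF \<alpha>] zeta_neq[OF n i(1)] by (simp add: inj_eq)
qed

text \<open>A new neighbouring pair \<open>Dual\<close>, \<open>Fix\<close> around the removed
  \<open>i\<close> would already be forbidden before: with \<open>i\<close> as its second point if
  \<open>w i = Fix\<close>, as its first if \<open>w i = Dual\<close>. Removing a kept point could
  create such a pair.\<close>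

lemma valid_comp_raise:
  assumes n: "n \<ge> 2" and i: "i \<in> {1..n}" and w: "valid n w" and wi: "w i \<noteq> Keep"
  shows "valid (n - 1) (w \<circ> raise i)"
  unfolding valid_def
proof (intro ballI notI)
  fix j assume j: "j \<in> {1..n - 1}"
  assume a: "(w \<circ> raise i) j = Dual \<and> (w \<circ> raise i) (zeta (n - 1) j) = Fix"
  then have d: "w (raise i j) = Dual" and f: "w (skip i (zeta n) (raise i j)) = Fix"
    by (simp_all only: o_def raise_zeta[OF n i j])
  have v: "w u = Dual \<Longrightarrow> w (zeta n u) \<noteq> Fix" if "u \<in> {1..n}" for u
    using w that by (auto simp: valid_def)
  show False
  proof (cases "zeta n (raise i j) = i")
    case True
    then show ?thesis
      using v[OF raise_mem[OF i j] d] v[OF i] f wi by (cases "w i") (auto simp: skip_def)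
  next
    case False
    then show ?thesis using v[OF raise_mem[OF i j] d] f by (simp add: skip_def)
  qed
qed

text \<open>Only points whose image under \<open>\<alpha>\<close> or \<open>zeta n\<close> is
  \<open>i\<close> are affected. Validity excludes the harmful configurations, except when
  \<open>i\<close> and \<open>u\<close> are both dual; then \<open>\<alpha>\<close> and
  \<open>zeta n\<close> agree at \<open>i\<close> and are rerouted alike.\<close>

lemma matches_remove_point:
  assumes n: "n \<ge> 2" and i: "i \<in> {1..n}" and w: "valid n w" and wi: "w i \<noteq> Keep"
    and \<alpha>: "\<alpha> permutes {1..n}" and mi: "matches n \<alpha> i (w i)" and j: "j \<in> {1..n - 1}"
  shows "matches (n - 1) (remove_point i \<alpha>) j (w (raise i j)) \<longleftrightarrow> matches n \<alpha> (raise i j) (w (raise i j))"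
proof -
  define u where "u = raise i j"
  have u: "u \<in> {1..n}" "u \<noteq> i" unfolding u_def using raise_mem[OF i j] by simp_all
  have inj: "\<alpha> a = \<alpha> b \<longleftrightarrow> a = b" for a b using permutes_inj[OF \<alpha>] by (rule inj_eq)
  have v: "w a = Dual \<Longrightarrow> w (zeta n a) \<noteq> Fix" if "a \<in> {1..n}" for a
    using w that by (auto simp: valid_def)
  have rp: "remove_point i \<alpha> j = k \<longleftrightarrow> skip i \<alpha> u = raise i k" for k
    unfolding u_def raise_remove_point[OF permutes_inj[OF \<alpha>], symmetric] by simp
  have fixed: "skip i \<alpha> u = u \<longleftrightarrow> \<alpha> u = u" if "w u = Fix"
  proof (cases "\<alpha> u = i")
    case True
    \<comment> \<open>Otherwise \<open>i\<close> and \<open>u\<close> form a 2-cycle, and removing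
      \<open>i\<close> would create a fixed point.\<close>
    have "\<alpha> i \<noteq> u"
    proof (cases "w i")
      case Fix
      then show ?thesis using mi u by simp
    next
      case Dual
      then show ?thesis using mi v[OF i] that by auto
    qed (use wi in simp)
    then show ?thesis using True u by (simp add: skip_def)
  qed (simp add: skip_def)
  have dual: "skip i \<alpha> u = skip i (zeta n) u \<longleftrightarrow> \<alpha> u = zeta n u" if "w u = Dual"
  proof (cases "w i")
    case Fix
    then have "\<alpha> u \<noteq> i" using mi inj[of u i] u by auto
    moreover have "zeta n u \<noteq> i" using v[OF u(1) that] Fix by auto
    ultimately show ?thesis by (simp add: skip_def)
  next
    case Dual
    then show ?thesis
      using mi inj[of u i] zeta_eq_iff[of n u i] u by (auto simp: skip_def)
  qed (use wi in simp)
  show ?thesis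
    unfolding u_def[symmetric]
    by (cases "w u")
      (use fixed dual raise_zeta[OF n i j] in \<open>simp_all add: rp u_def[symmetric]\<close>)
qed

lemma compatible_remove_point:
  assumes "n \<ge> 2" "i \<in> {1..n}" "valid n w" "w i \<noteq> Keep" "\<alpha> permutes {1..n}" "matches n \<alpha> i (w i)"
  shows "compatible (n - 1) (w \<circ> raise i) (remove_point i \<alpha>) \<longleftrightarrow> compatible n w \<alpha>"
proof -
  have s: "{1..n} = insert i (raise i ` {1..n - 1})" using raise_image[OF assms(2)] assms(2) by auto
  show ?thesis
    unfolding compatible_def s using matches_remove_point[OF assms] assms(6) by simp
qed

definition target :: "nat \<Rightarrow> letter \<Rightarrow> nat \<Rightarrow> nat" where
  "target n l i = (if l = Fix then i else zeta n i)"

lemma matches_iff_target: "l \<noteq> Keep \<Longrightarrow> matches n \<alpha> i l \<longleftrightarrow> \<alpha> i = target n l i"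
  by (cases l) (simp_all add: target_def)

section \<open>Closed classes and their cycle polynomials\<close>

locale closed_class =
  fixes C :: "sized_perm set"
  assumes perms: "perm_class C"
    and reductions: "closed_under_reductions C"
    and extensions: "closed_under_extensions C"
    and no_empty: "(0, id) \<notin> C"
begin

definition members :: "nat \<Rightarrow> (nat \<Rightarrow> nat) set" where
  "members n = {\<alpha>. (n, \<alpha>) \<in> C}"

lemma members_permutes: "\<alpha> \<in> members n \<Longrightarrow> \<alpha> permutes {1..n}"
  using perms by (auto simp: perm_class_def members_def)

lemma finite_members: "finite (members n)"
proof -
  have "members n \<subseteq> {\<alpha>. \<alpha> permutes {1..n}}" using members_permutes by blast
  then show ?thesis by (rule finite_subset) (rule finite_permutations[OF finite_atLeastAtMost])
qed

lemma members_remove_point_iff: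
  assumes \<alpha>: "\<alpha> permutes {1..n}" and i: "i \<in> {1..n}" and m: "l \<noteq> Keep" "matches n \<alpha> i l"
  shows "remove_point i \<alpha> \<in> members (n - 1) \<longleftrightarrow> \<alpha> \<in> members n"
proof -
  have "elementary_reduction (n, \<alpha>) (n - 1, remove_point i \<alpha>)"
    using m first_kind[OF \<alpha> i] second_kind[OF \<alpha> i] by (cases l) auto
  then show ?thesis
    using reductions extensions
    unfolding closed_under_reductions_def closed_under_extensions_def members_def by blast
qed

lemma members_0: "members 0 = {}"
  using members_permutes[of _ 0] no_empty by (force simp: members_def)

text \<open>The permutation of one point fixes it, so it would reduce to the empty
  permutation.\<close>

lemma members_1: "members 1 = {}"
proof -
  have False if a: "\<alpha> \<in> members 1" for \<alpha>
  proof -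
    have p: "\<alpha> permutes {1..1}" using members_permutes[OF a] .
    then have "matches 1 \<alpha> 1 Fix" by (simp add: permutes_sing)
    then show False using members_remove_point_iff[OF p, of 1 Fix] a members_0 by simp
  qed
  then show ?thesis by blast
qed

definition cycle_poly :: "nat \<Rightarrow> rat fps" where
  "cycle_poly n = (\<Sum>\<alpha>\<in>members n. fps_X ^ num_cycles n \<alpha>)"

lemma cycle_poly_0: "cycle_poly 0 = 0"
  by (simp add: cycle_poly_def members_0)

lemma Abs_fps_card:
  assumes "finite A"
  shows "Abs_fps (\<lambda>k. of_nat (card {a \<in> A. f a = k})) = (\<Sum>a\<in>A. fps_X ^ f a :: rat fps)"
proof (rule fps_ext)
  fix k
  have "(\<Sum>a\<in>A. fps_X ^ f a :: rat fps) $ k = (\<Sum>a\<in>A. if f a = k then 1 else 0)"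
    unfolding fps_sum_nth by (rule sum.cong) auto
  also have "\<dots> = of_nat (card {a \<in> A. f a = k})"
    using assms by (simp flip: sum.inter_filter)
  finally show "Abs_fps (\<lambda>k. of_nat (card {a \<in> A. f a = k})) $ k = (\<Sum>a\<in>A. fps_X ^ f a :: rat fps) $ k"
    by simp
qed

lemma all_gf_nth: "all_gf C $ n = cycle_poly n"
  using Abs_fps_card[OF finite_members, of n "num_cycles n"]
  by (simp add: all_gf_def gen_fun_def perm_count_def cycle_poly_def members_def)

lemma reduced_gf_nth:
  "reduced_gf C $ n = (\<Sum>\<alpha>\<in>members n. if reduced n \<alpha> then fps_X ^ num_cycles n \<alpha> else 0)"
proof -
  have "finite {\<alpha> \<in> members n. reduced n \<alpha>}" using finite_members by simp
  from Abs_fps_card[OF this, of "num_cycles n"]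
  have "reduced_gf C $ n = (\<Sum>\<alpha>\<in>{\<alpha> \<in> members n. reduced n \<alpha>}. fps_X ^ num_cycles n \<alpha>)"
    by (simp add: reduced_gf_def gen_fun_def reduced_count_def members_def conj_assoc)
  then show ?thesis by (simp only: sum.inter_filter[OF finite_members])
qed

text \<open>Induction removes one marked point at a time: a \<open>Fix\<close> takes a cycle with it
  and yields a factor y, a \<open>Dual\<close> leaves the number of cycles unchanged.\<close>

lemma sum_compatible:
  assumes "valid n w"
  shows "(\<Sum>\<alpha>\<in>members n. if compatible n w \<alpha> then fps_X ^ num_cycles n \<alpha> else 0)
    = (\<Prod>i\<in>{1..n}. letter_weight 1 fps_X 1 (w i)) * cycle_poly (card {i \<in> {1..n}. w i = Keep})"
  using assms
proof (induction n arbitrary: w)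
  case 0
  show ?case by (simp add: members_0 cycle_poly_0)
next
  case (Suc m)
  define n where "n = Suc m"
  show ?case unfolding n_def[symmetric]
  proof (cases "\<forall>i\<in>{1..n}. w i = Keep")
    case True
    then have "compatible n w \<alpha>" for \<alpha> by (simp add: compatible_def)
    moreover have "{i \<in> {1..n}. w i = Keep} = {1..n}" using True by auto
    moreover have "(\<Prod>i\<in>{1..n}. letter_weight 1 fps_X 1 (w i)) = (1 :: rat fps)"
      using True by (intro prod.neutral) auto
    ultimately show "(\<Sum>\<alpha>\<in>members n. if compatible n w \<alpha> then fps_X ^ num_cycles n \<alpha> else 0)
      = (\<Prod>i\<in>{1..n}. letter_weight 1 fps_X 1 (w i)) * cycle_poly (card {i \<in> {1..n}. w i = Keep})"
      by (simp add: cycle_poly_def)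
  next
    case False
    then obtain i where i: "i \<in> {1..n}" "w i \<noteq> Keep" by blast
    have n1: "n - 1 = m" by (simp add: n_def)
    show "(\<Sum>\<alpha>\<in>members n. if compatible n w \<alpha> then fps_X ^ num_cycles n \<alpha> else 0)
      = (\<Prod>i\<in>{1..n}. letter_weight 1 fps_X 1 (w i)) * cycle_poly (card {i \<in> {1..n}. w i = Keep})"
    \<comment> \<open>On one point a dual fixed point is also a fixed point, so the weight of
      \<open>Dual\<close> would be wrong; here both sides are 0 because there are no members of size
      0 or 1.\<close>
    proof (cases "n = 1")
      case True
      then have e: "{i \<in> {1..n}. w i = Keep} = {}" using i by auto
      show ?thesis using True members_1 unfolding e by (simp add: cycle_poly_0)
    next
      case False
      then have n2: "n \<ge> 2" by (simp add: n_def)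
      have v: "valid n w" using Suc.prems by (simp add: n_def)
      define t where "t = target n (w i) i"
      have t: "t \<in> {1..n}" using i zeta_mem[OF i(1)] by (simp add: t_def target_def)
      have mt: "matches n \<alpha> i (w i) \<longleftrightarrow> \<alpha> i = t" for \<alpha>
        unfolding t_def by (rule matches_iff_target[OF i(2)])
      define A where "A = {\<alpha> \<in> members n. \<alpha> i = t}"
      define B where "B = {\<alpha>. \<alpha> permutes {1..n} \<and> \<alpha> i = t}"
      \<comment> \<open>Closure in both directions makes \<open>A\<close> a full preimage, so the
        bijection on all permutations restricts to members.\<close>
      have AB: "A = {\<alpha> \<in> B. remove_point i \<alpha> \<in> members m}"
        unfolding A_def B_def n1[symmetric]
        using members_permutes members_remove_point_iff[OF _ i(1) i(2)] mt by blast
      have bij: "bij_betw (remove_point i) A (members m)"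
      proof (rule bij_betw_imageI)
        have b: "bij_betw (remove_point i) B {\<beta>. \<beta> permutes {1..m}}"
          using bij_betw_remove_point[OF i(1) t] by (simp only: B_def n1)
        have "A \<subseteq> B" unfolding AB by (rule Collect_restrict)
        with bij_betw_imp_inj_on[OF b] show "inj_on (remove_point i) A"
          by (rule inj_on_subset)
        have "members m \<subseteq> remove_point i ` B"
          unfolding bij_betw_imp_surj_on[OF b] using members_permutes[of _ m] by (intro subsetI CollectI)
        then show "remove_point i ` A = members m" unfolding AB by fast
      qed
      let ?f = "letter_weight 1 fps_X 1 (w i) :: rat fps"
      have summand: "(if compatible n w \<alpha> then fps_X ^ num_cycles n \<alpha> else 0)
          = ?f * (if compatible m (w \<circ> raise i) (remove_point i \<alpha>)
              then fps_X ^ num_cycles m (remove_point i \<alpha>) else 0)" if "\<alpha> \<in> A" for \<alpha>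
      proof -
        have \<alpha>: "\<alpha> permutes {1..n}" "\<alpha> i = t" using that members_permutes by (auto simp: A_def)
        then have mi: "matches n \<alpha> i (w i)" by (simp add: mt)
        have c: "compatible m (w \<circ> raise i) (remove_point i \<alpha>) \<longleftrightarrow> compatible n w \<alpha>"
          using compatible_remove_point[OF n2 i(1) v i(2) \<alpha>(1) mi] by (simp only: n1)
        have nc: "num_cycles n \<alpha> = num_cycles m (remove_point i \<alpha>) + (if \<alpha> i = i then 1 else 0)"
          using num_cycles_remove_point[OF \<alpha>(1) i(1)] n2 by (simp add: n1[symmetric])
        have "(fps_X ^ (if \<alpha> i = i then 1 else 0) :: rat fps) = ?f"
          using i(2) mi zeta_neq[OF n2 i(1)] by (cases "w i") auto
        then have "fps_X ^ num_cycles n \<alpha> = ?f * fps_X ^ num_cycles m (remove_point i \<alpha>)"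
          unfolding nc power_add by (simp only: mult.commute)
        then show ?thesis unfolding c by simp
      qed
      have "(\<Sum>\<alpha>\<in>members n. if compatible n w \<alpha> then fps_X ^ num_cycles n \<alpha> else 0)
          = (\<Sum>\<alpha>\<in>A. if compatible n w \<alpha> then fps_X ^ num_cycles n \<alpha> else (0 :: rat fps))"
      proof (rule sum.mono_neutral_right[OF finite_members])
        show "\<forall>\<alpha>\<in>members n - A. (if compatible n w \<alpha> then fps_X ^ num_cycles n \<alpha> else 0) = (0 :: rat fps)"
        proof
          fix \<alpha> assume "\<alpha> \<in> members n - A"
          then have "\<not> matches n \<alpha> i (w i)" by (simp add: A_def mt)
          then have "\<not> compatible n w \<alpha>" using i(1) unfolding compatible_def by blast
          then show "(if compatible n w \<alpha> then fps_X ^ num_cycles n \<alpha> else 0) = (0 :: rat fps)"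
            by simp
        qed
      qed (auto simp: A_def)
      also have "\<dots> = ?f * (\<Sum>\<beta>\<in>members m. if compatible m (w \<circ> raise i) \<beta> then fps_X ^ num_cycles m \<beta> else 0)"
        unfolding sum_distrib_left sum.reindex_bij_betw[OF bij, symmetric]
        using summand by (rule sum.cong[OF refl])
      also have "\<dots> = ?f * ((\<Prod>j\<in>{1..m}. letter_weight 1 fps_X 1 ((w \<circ> raise i) j))
          * cycle_poly (card {j \<in> {1..m}. (w \<circ> raise i) j = Keep}))"
        using Suc.IH valid_comp_raise[OF n2 i(1) v i(2)] by (simp only: n1)
      also have "card {j \<in> {1..m}. (w \<circ> raise i) j = Keep} = card {j \<in> {1..n}. w j = Keep}"
      proof (rule bij_betw_same_card)
        have "{j \<in> {1..n}. w j = Keep} = {j \<in> {1..n} - {i}. w j = Keep}"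
          using i(2) by blast
        also have "\<dots> = raise i ` {j \<in> {1..m}. (w \<circ> raise i) j = Keep}"
          unfolding raise_image[OF i(1), unfolded n1, symmetric] o_def by blast
        finally show "bij_betw (raise i) {j \<in> {1..m}. (w \<circ> raise i) j = Keep} {j \<in> {1..n}. w j = Keep}"
          by (intro bij_betw_imageI) (auto simp: inj_on_def)
      qed
      also have "?f * ((\<Prod>j\<in>{1..m}. letter_weight 1 fps_X 1 ((w \<circ> raise i) j))
          * cycle_poly (card {j \<in> {1..n}. w j = Keep}))
        = (?f * (\<Prod>j\<in>{1..n} - {i}. letter_weight 1 fps_X 1 (w j))) * cycle_poly (card {j \<in> {1..n}. w j = Keep})"
        unfolding raise_image[OF i(1), unfolded n1, symmetric]
        by (simp add: prod.reindex inj_on_def mult.assoc)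
      also have "?f * (\<Prod>j\<in>{1..n} - {i}. letter_weight 1 fps_X 1 (w j))
        = (\<Prod>j\<in>{1..n}. letter_weight 1 fps_X 1 (w j))"
        using i(1) by (simp only: prod.remove[OF finite_atLeastAtMost])
      finally show ?thesis .
    qed
  qed
qed

end

section \<open>Inclusion--exclusion\<close>

text \<open>The indicator is the product over \<open>i\<close> of 1 -
  [\<open>\<alpha> i = i\<close>] - [\<open>\<alpha> i = zeta n i\<close>]; for
  \<open>n \<ge> 2\<close> at most one bracket is 1. Expanding the product gives one term per
  word.\<close>

lemma reduced_indicator:
  assumes n: "n \<ge> 2" and \<alpha>: "\<alpha> permutes {1..n}"
  shows "(if reduced n \<alpha> then 1 else 0 :: rat fps)
    = (\<Sum>w\<in>words n. if compatible n w \<alpha> then \<Prod>i\<in>{1..n}. letter_weight 1 (- 1) (- 1) (w i) else 0)"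
proof -
  let ?e = "letter_weight 1 (- 1) (- 1) :: letter \<Rightarrow> rat fps"
  have inv: "inv \<alpha> (zeta n i) = i \<longleftrightarrow> \<alpha> i = zeta n i" for i
    using permutes_inv_eq[OF \<alpha>, of "zeta n i" i] by auto
  have one: "(\<Sum>l\<in>UNIV. if matches n \<alpha> i l then ?e l else 0)
      = (if \<alpha> i \<noteq> i \<and> (inv \<alpha> \<circ> zeta n) i \<noteq> i then 1 else 0)" if "i \<in> {1..n}" for i
    using zeta_neq[OF n that] by (simp add: sum_UNIV_letter inv)
  have all: "(\<Prod>i\<in>A. if P i then f i else 0 :: rat fps) = (if \<forall>i\<in>A. P i then prod f A else 0)"
    if "finite A" for A :: "nat set" and P f
    using that by induction auto
  have "(if reduced n \<alpha> then 1 else 0 :: rat fps)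
      = (\<Prod>i\<in>{1..n}. if \<alpha> i \<noteq> i \<and> (inv \<alpha> \<circ> zeta n) i \<noteq> i then 1 else 0)"
    unfolding all[OF finite_atLeastAtMost] reduced_def by simp
  also have "\<dots> = (\<Prod>i\<in>{1..n}. \<Sum>l\<in>UNIV. if matches n \<alpha> i l then ?e l else 0)"
    by (rule prod.cong[OF refl]) (simp only: one)
  also have "\<dots> = (\<Sum>w\<in>words n. \<Prod>i\<in>{1..n}. if matches n \<alpha> i (w i) then ?e (w i) else 0)"
    by (rule prod_sum_PiE) auto
  finally show ?thesis
    unfolding all[OF finite_atLeastAtMost] compatible_def .
qed

text \<open>With z as polynomial variable, each word becomes a monomial whose degree is its number
  of kept points, and sign and cycle weight separate.\<close>

lemma prod_letter_weight_poly:
  fixes y :: "'a::comm_ring_1"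
  assumes "finite A"
  shows "(\<Prod>i\<in>A. letter_weight [:0, 1:] (- [:y:]) (- 1) (w i))
    = monom ((\<Prod>i\<in>A. letter_weight 1 (- 1) (- 1) (w i)) * (\<Prod>i\<in>A. letter_weight 1 y 1 (w i)))
        (card {i \<in> A. w i = Keep})"
  using assms
proof induction
  case (insert j A)
  define a b where "a = (\<Prod>i\<in>A. letter_weight 1 (- 1) (- 1 :: 'a) (w i))"
    and "b = (\<Prod>i\<in>A. letter_weight 1 y 1 (w i))"
  define k where "k = card {i \<in> A. w i = Keep}"
  have IH: "(\<Prod>i\<in>A. letter_weight [:0, 1:] (- [:y:]) (- 1) (w i)) = monom (a * b) k"
    using insert.IH by (simp only: a_def b_def k_def)
  have "card {i \<in> insert j A. w i = Keep} = (if w j = Keep then Suc k else k)"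
  proof (cases "w j = Keep")
    case True
    then have "{i \<in> insert j A. w i = Keep} = insert j {i \<in> A. w i = Keep}" by blast
    then show ?thesis using insert.hyps True by (simp add: k_def)
  next
    case False
    then have "{i \<in> insert j A. w i = Keep} = {i \<in> A. w i = Keep}" by blast
    then show ?thesis using False by (simp add: k_def)
  qed
  moreover have "letter_weight [:0, 1:] (- [:y:]) (- 1) (w j) * monom (a * b) k
      = monom ((letter_weight 1 (- 1) (- 1) (w j) * a) * (letter_weight 1 y 1 (w j) * b))
          (if w j = Keep then Suc k else k)"
    by (cases "w j") (simp_all add: monom_Suc smult_monom minus_monom mult.left_commute)
  ultimately show ?case
    unfolding prod.insert[OF insert.hyps] IH a_def[symmetric] b_def[symmetric] by (simp only:)
qed simp

text \<open>The coefficient of \<open>z^m\<close> is the signed weight of the words with \<open>m\<close> kept points,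
  provided that \<open>n \<ge> 1\<close>.\<close>

definition word_poly :: "nat \<Rightarrow> rat fps poly" where
  "word_poly = lucas ([:0, 1:] - 1 - [:fps_X:]) [:fps_X:]"

lemma (in closed_class) reduced_gf_nth_word_poly:
  "reduced_gf C $ n = (\<Sum>m\<in>{0..n}. cycle_poly m * coeff (word_poly n) m)"
proof -
  consider "n = 0" | "n = 1" | "n \<ge> 2" by linarith
  then show ?thesis
  proof cases
    case 1
    then show ?thesis by (simp add: reduced_gf_nth members_0 cycle_poly_0)
  next
    case 2
    have "cycle_poly 1 = 0" unfolding cycle_poly_def members_1 by simp
    then show ?thesis unfolding reduced_gf_nth 2 members_1 by (simp add: cycle_poly_0)
  next
    case 3
    let ?s = "\<lambda>w. \<Prod>i\<in>{1..n}. letter_weight 1 (- 1) (- 1) (w i) :: rat fps"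
    let ?c = "\<lambda>w. \<Prod>i\<in>{1..n}. letter_weight 1 fps_X 1 (w i) :: rat fps"
    let ?k = "\<lambda>w. card {i \<in> {1..n}. w i = Keep}"
    have k: "?k w \<in> {0..n}" for w :: "nat \<Rightarrow> letter"
    proof -
      have "{i \<in> {1..n}. w i = Keep} \<subseteq> {1..n}" by blast
      from card_mono[OF finite_atLeastAtMost this] show ?thesis by simp
    qed
    have pick: "(\<Sum>m\<in>{0..n}. cycle_poly m * coeff (monom a j) m) = a * cycle_poly j"
      if "j \<in> {0..n}" for a j
    proof -
      have "(\<Sum>m\<in>{0..n}. cycle_poly m * coeff (monom a j) m)
          = (\<Sum>m\<in>{0..n}. if m = j then a * cycle_poly j else 0)"
        by (rule sum.cong) auto
      then show ?thesis using that by simp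
    qed
    have inner: "(\<Sum>\<alpha>\<in>members n. if compatible n w \<alpha> then fps_X ^ num_cycles n \<alpha> else 0)
        = (if valid n w then ?c w * cycle_poly (?k w) else 0)" for w
    proof (cases "valid n w")
      case True
      then show ?thesis by (simp only: sum_compatible if_True)
    next
      case False
      then have "\<not> compatible n w \<alpha>" if "\<alpha> \<in> members n" for \<alpha>
        using not_valid_imp_not_compatible[OF 3] members_permutes[OF that] by blast
      then show ?thesis using False by simp
    qed
    have "reduced_gf C $ n
        = (\<Sum>\<alpha>\<in>members n. (if reduced n \<alpha> then 1 else 0) * fps_X ^ num_cycles n \<alpha>)"
      unfolding reduced_gf_nth by (rule sum.cong) auto
    also have "\<dots> = (\<Sum>\<alpha>\<in>members n. \<Sum>w\<in>words n.
        (if compatible n w \<alpha> then ?s w else 0) * fps_X ^ num_cycles n \<alpha>)"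
      by (rule sum.cong[OF refl])
        (simp only: reduced_indicator[OF 3 members_permutes] sum_distrib_right)
    also have "\<dots> = (\<Sum>w\<in>words n. \<Sum>\<alpha>\<in>members n.
        (if compatible n w \<alpha> then ?s w else 0) * fps_X ^ num_cycles n \<alpha>)"
      by (rule sum.swap)
    also have "\<dots> = (\<Sum>w\<in>words n. ?s w *
        (\<Sum>\<alpha>\<in>members n. if compatible n w \<alpha> then fps_X ^ num_cycles n \<alpha> else 0))"
      unfolding sum_distrib_left by (intro sum.cong refl) simp
    also have "\<dots> = (\<Sum>w\<in>words n. if valid n w then ?s w * ?c w * cycle_poly (?k w) else 0)"
      unfolding inner by (intro sum.cong refl) simp
    also have "\<dots> = (\<Sum>w\<in>words n. \<Sum>m\<in>{0..n}. cycle_poly m *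
        coeff (if valid n w then monom (?s w * ?c w) (?k w) else 0) m)"
    proof (rule sum.cong[OF refl])
      fix w
      show "(if valid n w then ?s w * ?c w * cycle_poly (?k w) else 0) = (\<Sum>m\<in>{0..n}. cycle_poly m *
        coeff (if valid n w then monom (?s w * ?c w) (?k w) else 0) m)"
        by (cases "valid n w") (simp_all only: if_True if_False pick[OF k] coeff_0 mult_zero_right sum.neutral_const)
    qed
    also have "\<dots> = (\<Sum>m\<in>{0..n}. cycle_poly m *
        coeff (\<Sum>w\<in>words n. if valid n w then monom (?s w * ?c w) (?k w) else 0) m)"
      unfolding coeff_sum sum_distrib_left by (rule sum.swap)
    also have "(\<Sum>w\<in>words n. if valid n w then monom (?s w * ?c w) (?k w) else 0) = word_poly n"
      unfolding prod_letter_weight_poly[OF finite_atLeastAtMost, symmetric] word_poly_def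
      using 3 by (intro sum_valid_words) simp
    finally show ?thesis .
  qed
qed

section \<open>Series of signed words with a given number of kept points\<close>

definition word_gf :: "nat \<Rightarrow> fps2" where
  "word_gf m = Abs_fps (\<lambda>n. coeff (word_poly n) m)"

lemma word_poly_simps:
  "word_poly 0 = 2" "word_poly (Suc 0) = [:- 1 - fps_X, 1:]"
  "word_poly (Suc (Suc n)) = [:- 1 - fps_X, 1:] * word_poly (Suc n) - [:fps_X:] * word_poly n"
  by (simp_all add: word_poly_def one_pCons)

abbreviation gap_denominator :: fps2 where
  "gap_denominator \<equiv> (1 + xvar) * (1 + xvar * yvar)"

lemma gap_denominator_mult:
  "(gap_denominator * f) $ n = f $ n + (if n = 0 then 0 else (1 + fps_X) * f $ (n - 1))
    + (if n < 2 then 0 else fps_X * f $ (n - 2))"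
proof -
  have c: "fps_const (1 + fps_X :: rat fps) = 1 + yvar"
    by (simp only: fps_const_add[symmetric] fps_const_1_eq_1)
  have "gap_denominator * f = f + xvar * (fps_const (1 + fps_X) * f) + xvar ^ 2 * (yvar * f)"
    unfolding c by (simp add: algebra_simps power2_eq_square)
  then show ?thesis by (simp add: fps_X_power_mult_nth)
qed

lemma coeff_word_poly_Suc_Suc:
  "coeff (word_poly (Suc (Suc n))) m
    = (if m = 0 then 0 else coeff (word_poly (Suc n)) (m - 1))
      - (1 + fps_X) * coeff (word_poly (Suc n)) m - fps_X * coeff (word_poly n) m"
  by (cases m) (simp_all add: word_poly_simps(3) algebra_simps)

lemma coeff_word_poly_0_1:
  "coeff (word_poly 0) m = (if m = 0 then 2 else 0)"
  "coeff (word_poly (Suc 0)) m = (if m = 0 then - 1 - fps_X else if m = 1 then 1 else 0)"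
  by (auto simp: word_poly_simps coeff_pCons numeral_poly split: nat.splits)

text \<open>\<open>lucas a b\<close> has generating function (2 - a x) / (1 - a x + b x^2), here (2
  + x (1 + y) - x z) / (\<open>gap_denominator\<close> - x z). This is the part free of z.\<close>

lemma word_gf_0: "gap_denominator * word_gf 0 = 2 + xvar * (1 + yvar)"
proof (rule fps_ext)
  fix n
  consider "n = 0" | "n = Suc 0" | k where "n = Suc (Suc k)" by (metis not0_implies_Suc)
  then show "(gap_denominator * word_gf 0) $ n = (2 + xvar * (1 + yvar)) $ n"
    unfolding gap_denominator_mult
    by cases (simp_all add: word_gf_def coeff_word_poly_0_1 coeff_word_poly_Suc_Suc fps_numeral_nth algebra_simps)
qed

text \<open>The comparison of higher powers of z; the exception at \<open>m = 0\<close> is the term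
  -x z of the numerator.\<close>

lemma word_gf_Suc:
  "gap_denominator * word_gf (Suc m) = xvar * word_gf m - (if m = 0 then xvar else 0)"
proof (rule fps_ext)
  fix n
  consider "n = 0" | "n = Suc 0" | k where "n = Suc (Suc k)" by (metis not0_implies_Suc)
  then show "(gap_denominator * word_gf (Suc m)) $ n = (xvar * word_gf m - (if m = 0 then xvar else 0)) $ n"
    unfolding gap_denominator_mult
    by cases (auto simp: word_gf_def coeff_word_poly_0_1 coeff_word_poly_Suc_Suc)
qed

section \<open>Substitution of the compositional inverse\<close>

definition gap_gf :: fps2 where
  "gap_gf = xvar * inverse gap_denominator"

lemma gap_denominator_mult_gap_gf: "gap_denominator * gap_gf = xvar"
proof -
  have "gap_denominator * gap_gf = xvar * (gap_denominator * inverse gap_denominator)"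
    by (simp only: gap_gf_def mult.left_commute)
  also have "gap_denominator * inverse gap_denominator = 1"
    by (rule fps2_mult_inverse) simp
  finally show ?thesis by simp
qed

lemma gap_denominator_neq_0: "gap_denominator \<noteq> 0"
  using gap_denominator_mult_gap_gf by (metis fps_X_neq_zero mult_zero_left)

lemma gap_gf_nth_0: "gap_gf $ 0 = 0"
  by (simp add: gap_gf_def)

text \<open>Each further kept point multiplies by B. The exceptional numerator term affects only the
  passage from 0 to 1, so the geometric progression starts at 1.\<close>

lemma gap_gf_mult_word_gf: "gap_gf * word_gf (Suc m) = word_gf (Suc 0) * gap_gf ^ Suc m"
proof (induction m)
  case (Suc m)
  have "gap_denominator * word_gf (Suc (Suc m)) = gap_denominator * (gap_gf * word_gf (Suc m))"
    unfolding mult.assoc[symmetric] gap_denominator_mult_gap_gf by (simp add: word_gf_Suc)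
  then have "word_gf (Suc (Suc m)) = gap_gf * word_gf (Suc m)"
    using gap_denominator_neq_0 by (simp only: mult_cancel_left simp_thms)
  then show ?case by (simp only: Suc.IH power_Suc mult.left_commute)
qed simp

text \<open>In other words, \<open>word_gf (Suc 0)\<close> is x B'.\<close>

lemma word_gf_1: "gap_denominator\<^sup>2 * word_gf (Suc 0) = xvar * (1 - xvar ^ 2 * yvar)"
proof -
  have "gap_denominator\<^sup>2 * word_gf (Suc 0) = gap_denominator * (gap_denominator * word_gf (Suc 0))"
    by (simp only: power2_eq_square mult.assoc)
  also have "\<dots> = xvar * (gap_denominator * word_gf 0) - xvar * gap_denominator"
    by (simp only: word_gf_Suc if_True simp_thms right_diff_distrib[of gap_denominator]
        mult.left_commute[of gap_denominator xvar] mult.commute[of gap_denominator xvar])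
  also have "\<dots> = xvar * (2 + xvar * (1 + yvar)) - xvar * gap_denominator"
    by (simp only: word_gf_0)
  also have "x * (2 + x * (1 + y)) - x * ((1 + x) * (1 + x * y)) = x * (1 - x ^ 2 * y)" for x y :: fps2
    by (simp add: algebra_simps power2_eq_square)
  finally show ?thesis .
qed

lemma word_gf_nth_eq_0: "n < m \<Longrightarrow> word_gf m $ n = 0"
proof -
  have "coeff (word_poly n) m = 0" if "n < m" for n m
    using that
  proof (induction n arbitrary: m rule: less_induct)
    case (less n)
    consider "n = 0" | "n = Suc 0" | k where "n = Suc (Suc k)" by (metis not0_implies_Suc)
    then show ?case
      using less by cases (auto simp: coeff_word_poly_0_1 coeff_word_poly_Suc_Suc)
  qed
  then show "n < m \<Longrightarrow> word_gf m $ n = 0" by (simp add: word_gf_def)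
qed

context closed_class
begin

lemma reduced_gf_nth_word_gf:
  assumes "n \<le> N"
  shows "reduced_gf C $ n = (\<Sum>m\<in>{0..N}. cycle_poly m * word_gf m $ n)"
proof -
  have "reduced_gf C $ n = (\<Sum>m\<in>{0..n}. cycle_poly m * word_gf m $ n)"
    by (simp add: reduced_gf_nth_word_poly word_gf_def)
  also have "\<dots> = (\<Sum>m\<in>{0..N}. cycle_poly m * word_gf m $ n)"
    using assms by (intro sum.mono_neutral_left) (auto simp: word_gf_nth_eq_0)
  finally show ?thesis .
qed

text \<open>Summing the geometric progression against the cycle polynomials gives B R = x B'
  P(B).\<close>

lemma reduced_gf_eq_compose:
  "reduced_gf C * gap_gf = word_gf (Suc 0) * (all_gf C oo gap_gf)"
proof (rule fps_ext)
  fix n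
  have "(reduced_gf C * gap_gf) $ n
      = (\<Sum>j\<in>{0..n}. (\<Sum>m\<in>{0..n}. cycle_poly m * word_gf m $ j) * gap_gf $ (n - j))"
    unfolding fps_mult_nth by (rule sum.cong) (simp_all add: reduced_gf_nth_word_gf)
  also have "\<dots> = (\<Sum>m\<in>{0..n}. cycle_poly m * (word_gf m * gap_gf) $ n)"
    unfolding fps_mult_nth sum_distrib_left sum_distrib_right mult.assoc by (rule sum.swap)
  also have "\<dots> = (\<Sum>m\<in>{0..n}. cycle_poly m * (word_gf (Suc 0) * gap_gf ^ m) $ n)"
  proof (rule sum.cong[OF refl])
    fix m
    show "cycle_poly m * (word_gf m * gap_gf) $ n = cycle_poly m * (word_gf (Suc 0) * gap_gf ^ m) $ n"
      \<comment> \<open>The progression fails at \<open>m = 0\<close>, where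
        \<open>cycle_poly 0 = 0\<close> disposes of the term.\<close>
      using gap_gf_mult_word_gf[of "m - 1"]
      by (cases m) (simp_all only: cycle_poly_0 mult_zero_left diff_Suc_1 mult.commute)
  qed
  also have "\<dots> = (\<Sum>j\<in>{0..n}. word_gf (Suc 0) $ j * (\<Sum>m\<in>{0..n}. cycle_poly m * (gap_gf ^ m) $ (n - j)))"
    unfolding fps_mult_nth sum_distrib_left mult.left_commute[of "cycle_poly _"] by (rule sum.swap)
  also have "\<dots> = (word_gf (Suc 0) * (all_gf C oo gap_gf)) $ n"
    unfolding fps_mult_nth
  proof (rule sum.cong[OF refl])
    fix j assume "j \<in> {0..n}"
    have "(\<Sum>m\<in>{0..n}. cycle_poly m * (gap_gf ^ m) $ (n - j))
        = (\<Sum>m\<in>{0..n - j}. cycle_poly m * (gap_gf ^ m) $ (n - j))"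
      by (rule sum.mono_neutral_right) (auto simp: startsby_zero_power_prefix[OF gap_gf_nth_0])
    then show "word_gf (Suc 0) $ j * (\<Sum>m\<in>{0..n}. cycle_poly m * (gap_gf ^ m) $ (n - j))
        = word_gf (Suc 0) $ j * (all_gf C oo gap_gf) $ (n - j)"
      by (simp only: fps_compose_nth all_gf_nth)
  qed
  finally show "(reduced_gf C * gap_gf) $ n = (word_gf (Suc 0) * (all_gf C oo gap_gf)) $ n" .
qed

end

section \<open>Undoing the substitution\<close>

lemmas compose_simps = fps_compose_mult_distrib[OF div_y_noncrossing_nth_0] fps_compose_add_distrib
  fps_compose_sub_distrib fps_compose_1 fps_const_compose
  fps_compose_power[OF div_y_noncrossing_nth_0, symmetric] fps_X_fps_compose_startby0[OF div_y_noncrossing_nth_0]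

text \<open>Substituting A into \<open>gap_denominator * gap_gf = xvar\<close> gives q B(A) = A,
  while the quadratic equation says A = q x.\<close>

lemma gap_gf_compose_narayana: "gap_gf oo narayana_gf = xvar"
proof -
  define q where "q = (1 + narayana_gf) * (1 + narayana_gf * yvar)"
  have "q * (gap_gf oo narayana_gf) = gap_denominator * gap_gf oo narayana_gf"
    by (simp only: compose_simps q_def)
  also have "\<dots> = narayana_gf"
    unfolding gap_denominator_mult_gap_gf by (simp only: compose_simps)
  also have "\<dots> = q * xvar"
    unfolding q_def using narayana_functional_equation by (simp only: mult.commute)
  finally have "q * (gap_gf oo narayana_gf) = q * xvar" .
  moreover have "q $ 0 = 1" by (simp add: q_def div_y_noncrossing_nth_0)
  then have "q \<noteq> 0" by auto
  ultimately show ?thesis by (simp only: mult_cancel_left simp_thms)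
qed

theorem theorem4p2:
  fixes C :: "sized_perm set"
  assumes "perm_class C"
    and "closed_under_reductions C"
    and "closed_under_extensions C"
    and "(0, id) \<notin> C"
  shows "all_gf C =
    (reduced_gf C oo div_y (noncrossing_gf - 1))
      * inverse (fps2_sqrt ((xvar + xvar * yvar - 1) ^ 2 - 4 * xvar ^ 2 * yvar))"
proof -
  interpret closed_class C using assms by unfold_locales
  define A where "A = narayana_gf"
  define s where "s = narayana_root"
  define q where "q = (1 + A) * (1 + A * yvar)"
  define v where "v = word_gf (Suc 0) oo A"
  define R where "R = reduced_gf C oo A"
  define P where "P = all_gf C"
  have A: "A = xvar * q"
    unfolding q_def A_def using narayana_functional_equation by (simp only: mult.commute)
  have A0: "A \<noteq> 0" using A unfolding q_def by auto
  have "(reduced_gf C * gap_gf) oo A = (word_gf (Suc 0) * (all_gf C oo gap_gf)) oo A"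
    by (simp only: reduced_gf_eq_compose)
  then have "R * (gap_gf oo A) = v * (P oo (gap_gf oo A))"
    by (simp only: compose_simps R_def v_def P_def A_def
        fps_compose_assoc[OF div_y_noncrossing_nth_0 gap_gf_nth_0])
  then have R: "R * xvar = v * P"
    unfolding A_def gap_gf_compose_narayana by simp
  have "(gap_denominator\<^sup>2 * word_gf (Suc 0)) oo A = xvar * (1 - xvar ^ 2 * yvar) oo A"
    by (simp only: word_gf_1)
  then have v: "q\<^sup>2 * v = A * (1 - A\<^sup>2 * yvar)"
    by (simp only: compose_simps q_def v_def A_def)
  \<comment> \<open>The quadratic equation turns this into s = x (1 - y A^2) / A, whose numerator is
    the one occurring in x B' after substitution.\<close>
  have "s * A = A - xvar * A - xvar * yvar * A - 2 * (xvar * yvar * A\<^sup>2)"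
    by (simp add: s_def narayana_root_def A_def power2_eq_square algebra_simps)
  also have "A = x * ((1 + A) * (1 + A * y)) \<Longrightarrow>
     A - x * A - x * y * A - 2 * (x * y * A\<^sup>2) = x * (1 - A\<^sup>2 * y)" for x y :: fps2
    by algebra
  from this[OF A[unfolded q_def]] have "A - xvar * A - xvar * yvar * A - 2 * (xvar * yvar * A\<^sup>2)
      = xvar * (1 - A\<^sup>2 * yvar)" .
  finally have s: "s * A = xvar * (1 - A\<^sup>2 * yvar)" .
  \<comment> \<open>The factors x and q left over from the cleared denominators combine through A =
    x q into powers of A, which cancel.\<close>
  have "A * A * R = A * A * (s * P)"
  proof -
    have "A * A * R = xvar * q\<^sup>2 * (R * xvar)"
      by (subst (1 2) A) (simp only: power2_eq_square mult_ac)
    also have "\<dots> = xvar * (q\<^sup>2 * v) * P" unfolding R by (simp only: mult_ac)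
    also have "\<dots> = A * (xvar * (1 - A\<^sup>2 * yvar)) * P" unfolding v by (simp only: mult_ac)
    also have "\<dots> = A * A * (s * P)" unfolding s[symmetric] by (simp only: mult_ac)
    finally show ?thesis .
  qed
  then have "R = s * P" using A0 by (simp only: mult_cancel_left mult_eq_0_iff simp_thms)
  then have "R * inverse s = P * (s * inverse s)" by (simp only: mult_ac)
  also have "s * inverse s = 1"
    by (rule fps2_mult_inverse) (simp only: s_def narayana_root_nth(1))
  finally show ?thesis
    unfolding R_def P_def A_def s_def narayana_root_eq_sqrt by simp
qed

end
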